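(* Consider a density quantum neural network containing $K$ sub-unitaries $U_1(\boldsymbol{\theta}_1),\dots,U_K(\boldsymbol{\theta}_K)$, each acting on $n$ qubits, with state $$\rho(\boldsymbol{\theta},\boldsymbol{\alpha},\boldsymbol{x})=\sum_{k=1}^K\alpha_k\,U_k(\boldsymbol{\theta}_k)\,\rho(\boldsymbol{x})\,U_k^\dagger(\boldsymbol{\theta}_k),$$ and loss $\mathcal{L}(\boldsymbol{\theta},\boldsymbol{\alpha},\boldsymbol{x})=\mathrm{Tr}\big(\mathcal{H}\,\rho(\boldsymbol{\theta},\boldsymbol{\alpha},\boldsymbol{x})\big)$ for a Hermitian observable $\mathcal{H}$. Suppose each sub-unitary $U_k$ has a commuting-block structure with $B_k$ blocks, and that each sub-unitary has different parameters, i.e. $\boldsymbol{\theta}_k\neq\boldsymbol{\theta}_\ell$ for all $k\neq\ell$ (the parameters of different sub-unitaries are independent). Then an unbiased estimate of the gradient of $\mathcal{L}$ with respect to $\boldsymbol{\theta}$ can be obtained by classically post-processing $$\mathcal{O}\Big(2\sum_{k=1}^K B_k-K\Big)$$ circuits on $n+1$ qubits.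
   Context: In a density quantum neural network, $\rho(\boldsymbol{x})$ is a data-encoded $n$-qubit state (usually $\rho(\boldsymbol{x})=|\boldsymbol{x}\rangle\langle\boldsymbol{x}|$, $|\boldsymbol{x}\rangle=V(\boldsymbol{x})|0\rangle^{\otimes n}$ for a data-loading unitary $V(\boldsymbol{x})$), the $U_k(\boldsymbol{\theta}_k)$ are parameterised unitaries with real parameter vectors $\boldsymbol{\theta}_k$, and $\boldsymbol{\alpha}=\{\alpha_k\}_{k=1}^K$ is a probability distribution ($\alpha_k\ge 0$, $\sum_k\alpha_k=1$). The full parameter collection is $\boldsymbol{\theta}=\{\boldsymbol{\theta}_k\}_{k=1}^K$. A commuting-block circuit with $B$ blocks is a parameterised unitary of the form $$\mathcal{U}(\boldsymbol{\theta})=\prod_{b=1}^{B}\prod_{j=1}^{N_b}e^{i\theta^b_jG^b_j},$$ where $N_b$ is the number of gates in block $b$, the $\theta^b_j$ are real parameters, and the $G^b_j$ are Hermitian generators such that generators in the same block mutually commute, $[G^b_i,G^b_j]=0$ for all $i,j$ and each $b$. The number of circuits counts distinct quantum circuits whose measurement outcomes are classically post-processed to give an unbiased estimator of the gradient vector; it does not count repeated shots of the same circuit. *)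

theory Defs
  imports
    "HOL-Probability.Product_PMF"
    "HOL-Library.Landau_Symbols"
    "Jordan_Normal_Form.Schur_Decomposition"
begin

section \<open>Matrices, states and observables\<close>

definition hermitian_mat :: "nat \<Rightarrow> complex mat \<Rightarrow> bool" where
  "hermitian_mat d A \<longleftrightarrow> A \<in> carrier_mat d d \<and> mat_adjoint A = A"

definition unitary_mat :: "nat \<Rightarrow> complex mat \<Rightarrow> bool" where
  "unitary_mat d A \<longleftrightarrow> A \<in> carrier_mat d d \<and>
     A * mat_adjoint A = 1\<^sub>m d \<and> mat_adjoint A * A = 1\<^sub>m d"

definition mat_trace :: "complex mat \<Rightarrow> complex" where
  "mat_trace A = (\<Sum>i<dim_row A. A $$ (i, i))"

definition density_operator :: "nat \<Rightarrow> complex mat \<Rightarrow> bool" where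
  "density_operator d R \<longleftrightarrow> hermitian_mat d R \<and>
     (\<forall>v \<in> carrier_vec d. 0 \<le> Re ((R *\<^sub>v v) \<bullet>c v)) \<and> mat_trace R = 1"

definition mat_exp :: "complex mat \<Rightarrow> complex mat" where
  "mat_exp A = mat (dim_row A) (dim_row A) (\<lambda>(i, j). \<Sum>k. (A ^\<^sub>m k) $$ (i, j) / fact k)"

text \<open>The head of the list is the leftmost factor.\<close>

definition mat_list_prod :: "nat \<Rightarrow> complex mat list \<Rightarrow> complex mat" where
  "mat_list_prod d As = foldr (*) As (1\<^sub>m d)"

section \<open>Commuting-block circuits\<close>

text \<open>Indices are 0-based. The generator of gate \<open>j\<close> in block \<open>b\<close> is \<open>G b j\<close>, its parameter is
  \<open>\<theta> b j\<close>; only \<open>b < B\<close> and \<open>j < N b\<close> matter.\<close>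

definition block_circuit ::
    "nat \<Rightarrow> nat \<Rightarrow> (nat \<Rightarrow> nat) \<Rightarrow> (nat \<Rightarrow> nat \<Rightarrow> complex mat) \<Rightarrow> (nat \<Rightarrow> nat \<Rightarrow> real) \<Rightarrow> complex mat" where
  "block_circuit d B N G \<theta> =
     mat_list_prod d (map (\<lambda>b.
       mat_list_prod d (map (\<lambda>j. mat_exp ((\<i> * complex_of_real (\<theta> b j)) \<cdot>\<^sub>m G b j)) [0..<N b]))
       [0..<B])"

definition commuting_block_circuit ::
    "nat \<Rightarrow> nat \<Rightarrow> (nat \<Rightarrow> nat) \<Rightarrow> (nat \<Rightarrow> nat \<Rightarrow> complex mat) \<Rightarrow>
     ((nat \<Rightarrow> nat \<Rightarrow> real) \<Rightarrow> complex mat) \<Rightarrow> bool" where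
  "commuting_block_circuit d B N G U \<longleftrightarrow>
     1 \<le> B \<and>
     (\<forall>b<B. \<forall>j<N b. hermitian_mat d (G b j)) \<and>
     (\<forall>b<B. \<forall>i<N b. \<forall>j<N b. G b i * G b j = G b j * G b i) \<and>
     (\<forall>\<theta>. U \<theta> = block_circuit d B N G \<theta>)"

section \<open>Density quantum neural networks\<close>

text \<open>A parameter collection is \<open>\<theta> :: nat \<Rightarrow> nat \<Rightarrow> nat \<Rightarrow> real\<close>, where \<open>\<theta> k\<close> is the parameter vector of
  the sub-unitary \<open>U k\<close>. Every triple \<open>(k, b, j)\<close> is a separate coordinate, so no parameter is shared
  between different sub-unitaries.\<close>

definition param_index :: "nat \<Rightarrow> (nat \<Rightarrow> nat) \<Rightarrow> (nat \<Rightarrow> nat \<Rightarrow> nat) \<Rightarrow> (nat \<times> nat \<times> nat) set" where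
  "param_index K B N = {(k, b, j). k < K \<and> b < B k \<and> j < N k b}"

definition prob_vector :: "nat \<Rightarrow> (nat \<Rightarrow> real) \<Rightarrow> bool" where
  "prob_vector K \<alpha> \<longleftrightarrow> (\<forall>k<K. 0 \<le> \<alpha> k) \<and> (\<Sum>k<K. \<alpha> k) = 1"

definition dqnn_state ::
    "nat \<Rightarrow> nat \<Rightarrow> (nat \<Rightarrow> (nat \<Rightarrow> nat \<Rightarrow> real) \<Rightarrow> complex mat) \<Rightarrow>
     (nat \<Rightarrow> nat \<Rightarrow> nat \<Rightarrow> real) \<Rightarrow> (nat \<Rightarrow> real) \<Rightarrow> complex mat \<Rightarrow> complex mat" where
  "dqnn_state d K U \<theta> \<alpha> R =
     mat d d (\<lambda>(r, c). \<Sum>k<K. complex_of_real (\<alpha> k) *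
       (U k (\<theta> k) * R * mat_adjoint (U k (\<theta> k))) $$ (r, c))"

text \<open>The trace is real, since the observable and the state are Hermitian; \<open>Re\<close> only changes the
  type.\<close>

definition dqnn_loss ::
    "nat \<Rightarrow> nat \<Rightarrow> (nat \<Rightarrow> (nat \<Rightarrow> nat \<Rightarrow> real) \<Rightarrow> complex mat) \<Rightarrow> complex mat \<Rightarrow>
     (nat \<Rightarrow> nat \<Rightarrow> nat \<Rightarrow> real) \<Rightarrow> (nat \<Rightarrow> real) \<Rightarrow> complex mat \<Rightarrow> real" where
  "dqnn_loss d K U H \<theta> \<alpha> R = Re (mat_trace (H * dqnn_state d K U \<theta> \<alpha> R))"

definition has_gradient ::
    "((nat \<Rightarrow> nat \<Rightarrow> nat \<Rightarrow> real) \<Rightarrow> real) \<Rightarrow> (nat \<times> nat \<times> nat \<Rightarrow> real) \<Rightarrow> (nat \<times> nat \<times> nat) set \<Rightarrow>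
     (nat \<Rightarrow> nat \<Rightarrow> nat \<Rightarrow> real) \<Rightarrow> bool" where
  "has_gradient L g I \<theta> \<longleftrightarrow>
     (\<forall>(k, b, j) \<in> I.
        ((\<lambda>t. L (\<theta>(k := (\<theta> k)(b := (\<theta> k b)(j := t))))) has_real_derivative g (k, b, j))
          (at (\<theta> k b j)))"

section \<open>Quantum circuits and gradient estimators\<close>

text \<open>The \<open>n + 1\<close> qubit state given by an ancilla in \<open>|0>\<close> (the leading tensor factor) and the data
  register in the state \<open>R\<close>.\<close>

definition with_ancilla :: "nat \<Rightarrow> complex mat \<Rightarrow> complex mat" where
  "with_ancilla n R = four_block_mat R (0\<^sub>m (2 ^ n) (2 ^ n)) (0\<^sub>m (2 ^ n) (2 ^ n)) (0\<^sub>m (2 ^ n) (2 ^ n))"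

text \<open>Outcome distribution of a computational-basis measurement, by the Born rule, after a unitary
  \<open>Q\<close> has acted on the state \<open>S\<close>. It is meaningful for a unitary \<open>Q\<close> and a density operator \<open>S\<close>, as
  \<open>pmf_measure_circuit\<close> confirms.\<close>

definition measure_circuit :: "complex mat \<Rightarrow> complex mat \<Rightarrow> nat pmf" where
  "measure_circuit Q S =
     embed_pmf (\<lambda>s. if s < dim_row S then Re ((Q * S * mat_adjoint Q) $$ (s, s)) else 0)"

lemma mat_adjoint_index:
  assumes "A \<in> carrier_mat m d" "i < d" "j < m"
  shows "mat_adjoint A $$ (i, j) = cnj (A $$ (j, i))"
  using assms by (auto simp: mat_adjoint_def mat_of_rows_def)

lemma mat_adjoint_carrier:
  assumes "A \<in> carrier_mat m d"
  shows "mat_adjoint A \<in> carrier_mat d m"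
  using assms by (auto simp: mat_adjoint_def mat_of_rows_def)

lemma mat_trace_comm:
  assumes A: "A \<in> carrier_mat d d" and B: "B \<in> carrier_mat d d"
  shows "mat_trace (A * B) = mat_trace (B * A)"
proof -
  have "mat_trace (A * B) = (\<Sum>i<d. \<Sum>j<d. A $$ (i, j) * B $$ (j, i))"
    using A B by (auto simp: mat_trace_def scalar_prod_def lessThan_atLeast0 intro!: sum.cong)
  also have "\<dots> = (\<Sum>j<d. \<Sum>i<d. B $$ (j, i) * A $$ (i, j))"
    by (subst sum.swap) (simp add: mult.commute)
  also have "\<dots> = mat_trace (B * A)"
    using A B by (auto simp: mat_trace_def scalar_prod_def lessThan_atLeast0 intro!: sum.cong)
  finally show ?thesis .
qed

lemma pmf_measure_circuit:
  assumes Q: "unitary_mat d Q" and S: "density_operator d S"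
  shows "pmf (measure_circuit Q S) s =
    (if s < d then Re ((Q * S * mat_adjoint Q) $$ (s, s)) else 0)"
proof -
  have Qc: "Q \<in> carrier_mat d d" and Sc: "S \<in> carrier_mat d d"
    using Q S by (auto simp: unitary_mat_def density_operator_def hermitian_mat_def)
  note Ac = mat_adjoint_carrier[OF Qc]
  have nonneg: "0 \<le> Re ((Q * S * mat_adjoint Q) $$ (t, t))" if t: "t < d" for t
  proof -
    define v where "v = col (mat_adjoint Q) t"
    have v: "v \<in> carrier_vec d" using Ac t by (auto simp: v_def)
    have row: "row Q t = conjugate v"
      using Qc Ac t by (intro eq_vecI) (auto simp: v_def mat_adjoint_index[OF Qc])
    have "(Q * S * mat_adjoint Q) $$ (t, t) = (Q * (S * mat_adjoint Q)) $$ (t, t)"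
      using assoc_mult_mat[OF Qc Sc Ac] by simp
    also have "\<dots> = row Q t \<bullet> col (S * mat_adjoint Q) t"
      using Qc Sc Ac t by simp
    also have "col (S * mat_adjoint Q) t = S *\<^sub>v v"
      using col_mult2[OF Sc Ac t] by (simp add: v_def)
    also have "row Q t \<bullet> (S *\<^sub>v v) = (S *\<^sub>v v) \<bullet>c v"
      using Sc v unfolding row by (intro comm_scalar_prod[of _ d]) auto
    finally show ?thesis using S v by (auto simp: density_operator_def)
  qed
  have "(\<Sum>t<d. (Q * S * mat_adjoint Q) $$ (t, t)) = mat_trace (Q * (S * mat_adjoint Q))"
    using Qc Sc Ac assoc_mult_mat[OF Qc Sc Ac] by (simp add: mat_trace_def)
  also have "\<dots> = mat_trace (S * mat_adjoint Q * Q)"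
    using Qc Sc Ac by (intro mat_trace_comm) auto
  also have "S * mat_adjoint Q * Q = S"
    using Q Sc assoc_mult_mat[OF Sc Ac Qc] by (simp add: unitary_mat_def)
  also have "mat_trace S = 1" using S by (simp add: density_operator_def)
  finally have sum1: "(\<Sum>t<d. Re ((Q * S * mat_adjoint Q) $$ (t, t))) = 1"
    by (metis Re_sum one_complex.simps(1))
  define f where "f t = (if t < d then Re ((Q * S * mat_adjoint Q) $$ (t, t)) else 0)" for t
  have f0: "0 \<le> f t" for t using nonneg by (simp add: f_def)
  have "(\<integral>\<^sup>+ t. ennreal (f t) \<partial>count_space UNIV) = (\<Sum>t<d. ennreal (f t))"
    by (subst nn_integral_count_space'[of "{..<d}"]) (auto simp: f_def)
  also have "\<dots> = ennreal (\<Sum>t<d. f t)" using f0 by (intro sum_ennreal) auto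
  also have "(\<Sum>t<d. f t) = 1" using sum1 by (simp add: f_def)
  finally have "(\<integral>\<^sup>+ t. ennreal (f t) \<partial>count_space UNIV) = 1" by simp
  from pmf_embed_pmf[OF f0 this] have "pmf (embed_pmf f) s = f s" .
  moreover have "measure_circuit Q S = embed_pmf f"
    using Sc by (simp add: measure_circuit_def f_def[abs_def])
  ultimately show ?thesis by (simp add: f_def)
qed

text \<open>The circuits \<open>Q 0, \<dots>, Q (M - 1)\<close> are run independently, once each, on the data state \<open>R\<close>;
  \<open>post\<close> maps the tuple of outcomes to an estimate of every gradient component. Repeating a
  circuit and averaging does not change the expectation.\<close>

definition expected_estimate ::
    "nat \<Rightarrow> nat \<Rightarrow> (nat \<Rightarrow> complex mat) \<Rightarrow> ((nat \<Rightarrow> nat) \<Rightarrow> nat \<times> nat \<times> nat \<Rightarrow> real) \<Rightarrow> complex mat \<Rightarrow>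
     nat \<times> nat \<times> nat \<Rightarrow> real" where
  "expected_estimate n M Q post R p =
     measure_pmf.expectation (Pi_pmf {..<M} 0 (\<lambda>i. measure_circuit (Q i) (with_ancilla n R)))
       (\<lambda>outcomes. post outcomes p)"

end

theory Submission
  imports Defs
begin

text \<open>The generators of a block have a common eigenbasis, so a parameter of the block enters the circuit
  only through phases \<open>cis (t * g a)\<close> on the basis vectors. With \<open>\<sigma>\<close> the state after the block and \<open>K\<close> the
  observable pulled back to it, both written in that basis, the derivative is
  \<open>- 2 * (\<Sum>a. g a * Im ((\<sigma> * K) $$ (a, a)))\<close>. The observable is, up to a scalar, the mean of a unitary
  \<open>W\<close> and its adjoint, and a Hadamard test for a unitary \<open>T\<close> yields all \<open>Im ((\<sigma> * mat_adjoint T) $$ (a, a))\<close>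
  in one circuit, as differences of outcome probabilities. Hence two circuits per block suffice, and
  \<open>2 * (\<Sum>k<K. B k) \<le> 2 * (2 * (\<Sum>k<K. B k) - K)\<close> because every \<open>B k\<close> is at least 1.\<close>

section \<open>Common eigenbases of commuting Hermitian matrices\<close>

text \<open>Measuring the data register in the common eigenbasis reveals diagonal entries of a
  state, but \<open>\<sigma> * K\<close> is in general not Hermitian, and the imaginary parts of its
  diagonal are not probabilities of such a measurement. They are interference terms. This is what
  the ancilla is for: it superposes applying a gate with not applying it. The gate has to be
  unitary, which an observable need not be, hence the detour through \<open>W\<close>; and since
  \<open>W\<close> need not be Hermitian, \<open>W\<close> and its adjoint are tested separately,
  which is where the factor 2 comes from. The circuits are built from \<open>\<theta>\<close>, the
  generators and the observable alone, so they serve every data state. The eigenvalues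
  \<open>g\<close> and the mixture weights \<open>\<alpha>\<close> enter only the classical
  post-processing. The common eigenbasis rests on Schur triangularization. Instead of restricting
  matrices to subspaces, the argument iterates \<open>A - \<mu>\<close> inside sets that are closed
  under these maps; joint eigenspaces and orthogonal complements are the sets that occur.\<close>

lemma mat_adjoint_mult:
  assumes A: "A \<in> carrier_mat m d" and B: "B \<in> carrier_mat d l"
  shows "mat_adjoint (A * B) = mat_adjoint B * (mat_adjoint A :: complex mat)"
proof (rule eq_matI)
  note AB = mult_carrier_mat[OF A B]
  fix i j assume "i < dim_row (mat_adjoint B * mat_adjoint A)"
    "j < dim_col (mat_adjoint B * mat_adjoint A)"
  then have ij: "i < l" "j < m" using mat_adjoint_carrier[OF A] mat_adjoint_carrier[OF B] by auto
  have "mat_adjoint (A * B) $$ (i, j) = (\<Sum>k\<in>{0..<d}. cnj (A $$ (j, k) * B $$ (k, i)))"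
    using ij A B unfolding mat_adjoint_index[OF AB ij] by (simp add: scalar_prod_def)
  also have "\<dots> = (mat_adjoint B * mat_adjoint A) $$ (i, j)"
    using ij A B mat_adjoint_carrier[OF A] mat_adjoint_carrier[OF B]
    by (auto simp: scalar_prod_def mat_adjoint_index[OF A] mat_adjoint_index[OF B] mult.commute
        intro!: sum.cong)
  finally show "mat_adjoint (A * B) $$ (i, j) = (mat_adjoint B * mat_adjoint A) $$ (i, j)" .
qed (use carrier_matD[OF mat_adjoint_carrier[OF A]] carrier_matD[OF mat_adjoint_carrier[OF B]]
      carrier_matD[OF mat_adjoint_carrier[OF mult_carrier_mat[OF A B]]] in auto)

lemma mat_adjoint_adjoint:
  assumes "A \<in> carrier_mat m d"
  shows "mat_adjoint (mat_adjoint A) = (A :: complex mat)"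
  using assms mat_adjoint_carrier[OF assms] mat_adjoint_carrier[OF mat_adjoint_carrier[OF assms]]
  by (intro eq_matI) (auto simp: mat_adjoint_index[OF assms]
      mat_adjoint_index[OF mat_adjoint_carrier[OF assms]])

text \<open>Cayley-Hamilton in constructive form: applying the factors \<open>A - l i\<close> one
  after another to \<open>v\<close> stays in \<open>V\<close> and reaches zero after
  \<open>d\<close> steps, so the last nonzero iterate is an eigenvector in \<open>V\<close>.\<close>

lemma eigenvector_in_invariant_set:
  fixes A :: "complex mat"
  assumes A: "A \<in> carrier_mat d d" and V: "V \<subseteq> carrier_vec d"
    and inv: "\<And>u \<mu>. u \<in> V \<Longrightarrow> A *\<^sub>v u - \<mu> \<cdot>\<^sub>v u \<in> V"
    and v: "v \<in> V" "v \<noteq> 0\<^sub>v d"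
  shows "\<exists>w\<in>V. w \<noteq> 0\<^sub>v d \<and> (\<exists>\<mu>. A *\<^sub>v w = \<mu> \<cdot>\<^sub>v w)"
proof -
  obtain es where "char_poly A = (\<Prod>a\<leftarrow>es. [:- a, 1:])"
    using char_poly_factorized[OF A] by auto
  from schur_decomposition_exists[OF A this] obtain B where ut: "upper_triangular B"
    and "similar_mat A B" by auto
  then obtain P Q where "similar_mat_wit A B P Q" by (auto simp: similar_mat_def)
  from similar_mat_witD2[OF A this] have PQ: "P * Q = 1\<^sub>m d" and QP: "Q * P = 1\<^sub>m d"
    and AB: "A = P * B * Q" and B: "B \<in> carrier_mat d d" and P: "P \<in> carrier_mat d d"
    and Q: "Q \<in> carrier_mat d d" by auto
  have "Q * A = Q * P * B * Q" using P Q B by (simp add: AB assoc_mult_mat[of _ d d _ d _ d])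
  then have QA: "Q * A = B * Q" using B Q QP by simp
  \<comment> \<open>The diagonal of the triangular form is read from the bottom up, so that step
    \<open>i\<close> clears coordinate \<open>d - Suc i\<close>.\<close>
  define l where "l i = B $$ (d - Suc i, d - Suc i)" for i
  define x where "x = rec_nat v (\<lambda>i u. A *\<^sub>v u - l i \<cdot>\<^sub>v u)"
  have x0: "x 0 = v" and xS: "x (Suc i) = A *\<^sub>v x i - l i \<cdot>\<^sub>v x i" for i
    by (simp_all add: x_def)
  have xV: "x i \<in> V" for i by (induction i) (use v inv xS x0 in auto)
  then have xc: "x i \<in> carrier_vec d" for i using V by auto
  have step: "Q *\<^sub>v x (Suc i) = B *\<^sub>v (Q *\<^sub>v x i) - l i \<cdot>\<^sub>v (Q *\<^sub>v x i)" for i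
  proof -
    have "Q *\<^sub>v x (Suc i) = Q *\<^sub>v (A *\<^sub>v x i) - Q *\<^sub>v (l i \<cdot>\<^sub>v x i)"
      unfolding xS using A Q xc[of i] by (intro mult_minus_distrib_mat_vec) auto
    also have "Q *\<^sub>v (A *\<^sub>v x i) = B *\<^sub>v (Q *\<^sub>v x i)"
      using A B Q xc[of i] QA by (metis assoc_mult_mat_vec)
    finally show ?thesis using Q xc[of i] by (simp add: mult_mat_vec[of _ d d])
  qed
  \<comment> \<open>After \<open>i\<close> steps the last \<open>i\<close> coordinates vanish in the
    Schur basis. In row \<open>r\<close> of the next step, triangularity removes the columns left of
    \<open>r\<close> and the induction hypothesis those right of it. The remaining diagonal term is
    cancelled by \<open>l i\<close> if \<open>r = d - Suc i\<close>; otherwise the coordinate is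
    zero already.\<close>
  have zero: "(Q *\<^sub>v x i) $ r = 0" if "i \<le> d" "d - i \<le> r" "r < d" for i r
    using that
  proof (induction i arbitrary: r)
    case 0
    then show ?case by simp
  next
    case (Suc i)
    define y where "y = Q *\<^sub>v x i"
    have y: "y \<in> carrier_vec d" using Q xc by (auto simp: y_def)
    have y0: "y $ c = 0" if "r < c" "c < d" for c
      using Suc.IH[of c] Suc.prems that by (auto simp: y_def)
    have "(B *\<^sub>v y) $ r = (\<Sum>c\<in>{0..<d}. B $$ (r, c) * y $ c)"
      using B y Suc.prems by (auto simp: scalar_prod_def)
    also have "\<dots> = (\<Sum>c\<in>{r}. B $$ (r, c) * y $ c)"
    proof (intro sum.mono_neutral_right ballI)
      fix c assume c: "c \<in> {0..<d} - {r}"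
      show "B $$ (r, c) * y $ c = 0"
      proof (cases "c < r")
        case True
        then show ?thesis using upper_triangularD[OF ut True] B Suc.prems by simp
      qed (use c y0 in auto)
    qed (use Suc.prems in auto)
    finally have By: "(B *\<^sub>v y) $ r = B $$ (r, r) * y $ r" by simp
    have "B $$ (r, r) * y $ r = l i * y $ r"
    proof (cases "r = d - Suc i")
      case False
      then have "y $ r = 0" using Suc.IH[of r] Suc.prems by (auto simp: y_def)
      then show ?thesis by simp
    qed (simp add: l_def)
    then show ?case using step[of i] By B y Suc.prems by (simp add: y_def[symmetric])
  qed
  have "x d = 0\<^sub>v d"
  proof -
    have "Q *\<^sub>v x d = 0\<^sub>v d" using zero[of d] Q by (intro eq_vecI) auto
    then have "P *\<^sub>v (Q *\<^sub>v x d) = 0\<^sub>v d" using P by (intro eq_vecI) auto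
    then show ?thesis using P Q PQ xc[of d]
      by (metis assoc_mult_mat_vec one_mult_mat_vec)
  qed
  then obtain m where m: "x m = 0\<^sub>v d" "\<And>i. i < m \<Longrightarrow> x i \<noteq> 0\<^sub>v d"
    using exists_least_iff[of "\<lambda>m. x m = 0\<^sub>v d"] by auto
  then obtain i where i: "m = Suc i" using v x0 by (cases m) auto
  have "A *\<^sub>v x i = l i \<cdot>\<^sub>v x i"
  proof (rule eq_vecI)
    fix r assume "r < dim_vec (l i \<cdot>\<^sub>v x i)"
    then have r: "r < d" using xc[of i] by simp
    have "(A *\<^sub>v x i - l i \<cdot>\<^sub>v x i) $ r = 0" using m(1) xS[of i] i r by simp
    then show "(A *\<^sub>v x i) $ r = (l i \<cdot>\<^sub>v x i) $ r" using r xc[of i] A by simp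
  qed (use A xc[of i] in auto)
  then show ?thesis using xV[of i] m(2)[of i] i by auto
qed

text \<open>Induction on the number of matrices: a joint eigenspace of the earlier ones inside
  \<open>V\<close> is invariant under the next one because they commute, so the case of a single
  matrix applies to it.\<close>

lemma common_eigenvector_in_invariant_set:
  fixes A :: "nat \<Rightarrow> complex mat"
  assumes A: "\<And>j. j < n \<Longrightarrow> A j \<in> carrier_mat d d"
    and comm: "\<And>i j. i < n \<Longrightarrow> j < n \<Longrightarrow> A i * A j = A j * A i"
    and V: "V \<subseteq> carrier_vec d"
    and inv: "\<And>j u \<mu>. j < n \<Longrightarrow> u \<in> V \<Longrightarrow> A j *\<^sub>v u - \<mu> \<cdot>\<^sub>v u \<in> V"
    and v: "v \<in> V" "v \<noteq> 0\<^sub>v d"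
  shows "\<exists>w\<in>V. w \<noteq> 0\<^sub>v d \<and> (\<forall>j<n. \<exists>\<mu>. A j *\<^sub>v w = \<mu> \<cdot>\<^sub>v w)"
  using A comm inv
proof (induction n)
  case 0
  then show ?case using v by auto
next
  case (Suc n)
  then obtain w where w: "w \<in> V" "w \<noteq> 0\<^sub>v d" "\<forall>j<n. \<exists>\<mu>. A j *\<^sub>v w = \<mu> \<cdot>\<^sub>v w"
    by (metis less_Suc_eq)
  then obtain l where l: "\<And>j. j < n \<Longrightarrow> A j *\<^sub>v w = l j \<cdot>\<^sub>v w" by metis
  \<comment> \<open>The eigenvalues \<open>l j\<close> are those of the one vector \<open>w\<close>
    found so far; fixing them makes \<open>W\<close> a joint eigenspace within \<open>V\<close>,
    nonzero because it contains \<open>w\<close>.\<close>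
  define W where "W = {u\<in>V. \<forall>j<n. A j *\<^sub>v u = l j \<cdot>\<^sub>v u}"
  have An: "A n \<in> carrier_mat d d" using Suc.prems by simp
  have "A n *\<^sub>v u - \<mu> \<cdot>\<^sub>v u \<in> W" if u: "u \<in> W" for u \<mu>
  proof -
    have uc: "u \<in> carrier_vec d" using u V by (auto simp: W_def)
    have "A j *\<^sub>v (A n *\<^sub>v u - \<mu> \<cdot>\<^sub>v u) = l j \<cdot>\<^sub>v (A n *\<^sub>v u - \<mu> \<cdot>\<^sub>v u)" if j: "j < n" for j
    proof -
      have Aj: "A j \<in> carrier_mat d d" using Suc.prems j by simp
      have lu: "A j *\<^sub>v u = l j \<cdot>\<^sub>v u" using u j by (auto simp: W_def)
      have "A j *\<^sub>v (A n *\<^sub>v u - \<mu> \<cdot>\<^sub>v u) = A j *\<^sub>v (A n *\<^sub>v u) - A j *\<^sub>v (\<mu> \<cdot>\<^sub>v u)"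
        using Aj An uc by (intro mult_minus_distrib_mat_vec) auto
      also have "A j *\<^sub>v (A n *\<^sub>v u) = A n *\<^sub>v (A j *\<^sub>v u)"
        using Aj An uc Suc.prems(2)[of j n] j by (metis assoc_mult_mat_vec less_Suc_eq)
      also have "\<dots> = l j \<cdot>\<^sub>v (A n *\<^sub>v u)"
        using An uc by (simp add: lu mult_mat_vec[of _ d d])
      also have "A j *\<^sub>v (\<mu> \<cdot>\<^sub>v u) = l j \<cdot>\<^sub>v (\<mu> \<cdot>\<^sub>v u)"
        using Aj uc by (simp add: lu mult_mat_vec[of _ d d] smult_smult_assoc mult.commute)
      also have "l j \<cdot>\<^sub>v (A n *\<^sub>v u) - l j \<cdot>\<^sub>v (\<mu> \<cdot>\<^sub>v u) = l j \<cdot>\<^sub>v (A n *\<^sub>v u - \<mu> \<cdot>\<^sub>v u)"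
        using An uc by (intro eq_vecI) (auto simp: algebra_simps)
      finally show ?thesis .
    qed
    then show ?thesis using u Suc.prems(3)[of n u \<mu>] by (auto simp: W_def)
  qed
  moreover have "W \<subseteq> carrier_vec d" using V by (auto simp: W_def)
  moreover have "w \<in> W" using w l by (auto simp: W_def)
  ultimately obtain z where "z \<in> W" "z \<noteq> 0\<^sub>v d" "\<exists>\<mu>. A n *\<^sub>v z = \<mu> \<cdot>\<^sub>v z"
    using eigenvector_in_invariant_set[OF An, of W w] w(2) by blast
  then show ?case by (intro bexI[of _ z]) (auto simp: W_def less_Suc_eq)
qed

text \<open>The conjugated \<open>e i\<close> are the first rows of a square matrix whose remaining
  rows are zero. As \<open>k < d\<close> there is a zero row, so the matrix is singular, and a
  kernel vector is orthogonal to all \<open>e i\<close>.\<close>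

lemma exists_orthogonal_vec:
  fixes e :: "nat \<Rightarrow> complex vec"
  assumes "k < d" and e: "\<And>i. i < k \<Longrightarrow> e i \<in> carrier_vec d"
  shows "\<exists>v\<in>carrier_vec d. v \<noteq> 0\<^sub>v d \<and> (\<forall>i<k. v \<bullet>c e i = 0)"
proof -
  define M where "M = mat\<^sub>r d d (\<lambda>i. if i = k then 0\<^sub>v d else if i < k then conjugate (e i) else 0\<^sub>v d)"
  have Mc: "M \<in> carrier_mat d d" by (simp add: M_def)
  have "det M = 0" unfolding M_def using assms by (intro det_row_0) auto
  then obtain v where v: "v \<in> carrier_vec d" "v \<noteq> 0\<^sub>v d" "M *\<^sub>v v = 0\<^sub>v d"
    using det_0_iff_vec_prod_zero[OF Mc] by auto
  have "v \<bullet>c e i = 0" if "i < k" for i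
  proof -
    have "row M i = conjugate (e i)" using that assms e[OF that]
      by (simp add: M_def)
    moreover have "(M *\<^sub>v v) $ i = row M i \<bullet> v" using that assms Mc by simp
    ultimately have "conjugate (e i) \<bullet> v = 0" using v(3) that assms by simp
    then show ?thesis using v(1) e[OF that] by (metis carrier_vec_conjugate comm_scalar_prod)
  qed
  then show ?thesis using v by auto
qed

lemma hermitian_mat_inner:
  assumes A: "hermitian_mat d A" and u: "u \<in> carrier_vec d" and w: "w \<in> carrier_vec d"
  shows "(A *\<^sub>v u) \<bullet>c w = u \<bullet>c (A *\<^sub>v w)"
proof -
  have Ac: "A \<in> carrier_mat d d" and Aa: "mat_adjoint A = A"
    using A by (auto simp: hermitian_mat_def)
  have sym: "cnj (A $$ (i, j)) = A $$ (j, i)" if "i < d" "j < d" for i j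
    using mat_adjoint_index[OF Ac, of j i] Aa that by simp
  have "(A *\<^sub>v u) \<bullet>c w = (\<Sum>i\<in>{0..<d}. \<Sum>j\<in>{0..<d}. A $$ (i, j) * u $ j * cnj (w $ i))"
    using Ac u w by (simp add: scalar_prod_def sum_distrib_right)
  also have "\<dots> = (\<Sum>j\<in>{0..<d}. \<Sum>i\<in>{0..<d}. A $$ (i, j) * u $ j * cnj (w $ i))"
    by (rule sum.swap)
  also have "\<dots> = u \<bullet>c (A *\<^sub>v w)"
    using Ac u w by (auto simp: scalar_prod_def sum_distrib_left sym intro!: sum.cong)
  finally show ?thesis .
qed

text \<open>The orthogonal complement \<open>V\<close> of the eigenvectors found so far is
  invariant: a Hermitian matrix can be moved to the other side of the inner product, where it only
  rescales \<open>e i\<close>. Hence \<open>V\<close> contains a further common eigenvector, which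
  is then normalized.\<close>

lemma orthonormal_common_eigenvectors:
  fixes A :: "nat \<Rightarrow> complex mat"
  assumes A: "\<And>j. j < n \<Longrightarrow> hermitian_mat d (A j)"
    and comm: "\<And>i j. i < n \<Longrightarrow> j < n \<Longrightarrow> A i * A j = A j * A i"
    and "k \<le> d"
  shows "\<exists>e. (\<forall>i<k. e i \<in> carrier_vec d \<and> (\<forall>j<n. \<exists>\<mu>. A j *\<^sub>v e i = \<mu> \<cdot>\<^sub>v e i)) \<and>
    (\<forall>i<k. \<forall>j<k. e i \<bullet>c e j = (if i = j then 1 else 0))"
  using \<open>k \<le> d\<close>
proof (induction k)
  case 0
  then show ?case by auto
next
  case (Suc k)
  then obtain e where e: "\<And>i. i < k \<Longrightarrow> e i \<in> carrier_vec d"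
    and ev: "\<And>i j. i < k \<Longrightarrow> j < n \<Longrightarrow> \<exists>\<mu>. A j *\<^sub>v e i = \<mu> \<cdot>\<^sub>v e i"
    and on: "\<And>i j. i < k \<Longrightarrow> j < k \<Longrightarrow> e i \<bullet>c e j = (if i = j then 1 else 0)"
    by (metis Suc_leD)
  have Ac: "A j \<in> carrier_mat d d" if "j < n" for j using A[OF that] by (simp add: hermitian_mat_def)
  define V where "V = {u\<in>carrier_vec d. \<forall>i<k. u \<bullet>c e i = 0}"
  have inv: "A j *\<^sub>v u - \<mu> \<cdot>\<^sub>v u \<in> V" if j: "j < n" and u: "u \<in> V" for j u \<mu>
  proof -
    have uc: "u \<in> carrier_vec d" using u by (simp add: V_def)
    have "(A j *\<^sub>v u - \<mu> \<cdot>\<^sub>v u) \<bullet>c e i = 0" if i: "i < k" for i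
    proof -
      obtain l where l: "A j *\<^sub>v e i = l \<cdot>\<^sub>v e i" using ev i j by blast
      have "(A j *\<^sub>v u) \<bullet>c e i = u \<bullet>c (l \<cdot>\<^sub>v e i)"
        using hermitian_mat_inner[OF A[OF j] uc e[OF i]] l by simp
      also have "\<dots> = 0" using u i uc e[OF i] by (simp add: V_def conjugate_smult_vec)
      finally have "(A j *\<^sub>v u) \<bullet>c e i = 0" .
      then show ?thesis using u i uc e[OF i] Ac[OF j]
        by (simp add: V_def minus_scalar_prod_distrib[of _ d])
    qed
    then show ?thesis using uc Ac[OF j] by (simp add: V_def)
  qed
  obtain v where "v \<in> V" "v \<noteq> 0\<^sub>v d"
    using exists_orthogonal_vec[of k d e] Suc.prems e by (auto simp: V_def)
  then obtain w where w: "w \<in> V" "w \<noteq> 0\<^sub>v d" "\<And>j. j < n \<Longrightarrow> \<exists>\<mu>. A j *\<^sub>v w = \<mu> \<cdot>\<^sub>v w"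
    using common_eigenvector_in_invariant_set[of n A d V v, OF Ac comm _ inv] by (auto simp: V_def)
  have wc: "w \<in> carrier_vec d" using w by (simp add: V_def)
  define s where "s = Re (w \<bullet>c w)"
  \<comment> \<open>Positivity in the order on \<open>complex\<close> includes a vanishing imaginary
    part, so the squared norm equals its real part \<open>s\<close>.\<close>
  have "w \<bullet>c w > 0" using w wc conjugate_square_greater_0_vec by blast
  then have s: "s > 0" "w \<bullet>c w = of_real s" by (auto simp: s_def less_complex_def complex_eq_iff)
  define z where "z = complex_of_real (1 / sqrt s) \<cdot>\<^sub>v w"
  have zc: "z \<in> carrier_vec d" using wc by (simp add: z_def)
  have "z \<bullet>c z = complex_of_real (1 / sqrt s * (1 / sqrt s) * s)"
    using wc s by (simp add: z_def conjugate_smult_vec flip: of_real_mult)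
  also have "1 / sqrt s * (1 / sqrt s) * s = 1" using s by simp
  finally have zz: "z \<bullet>c z = 1" by simp
  have ze: "z \<bullet>c e i = 0" if "i < k" for i
    using w that wc e[OF that] by (simp add: z_def V_def)
  have ez: "e i \<bullet>c z = 0" if "i < k" for i
    using conjugate_vec_sprod_comm[of z d "e i"] ze[OF that] e[OF that] zc
    by (metis conjugate_conjugate_sprod conjugate_zero)
  have zev: "\<exists>\<mu>. A j *\<^sub>v z = \<mu> \<cdot>\<^sub>v z" if "j < n" for j
  proof -
    obtain l where "A j *\<^sub>v w = l \<cdot>\<^sub>v w" using w(3) \<open>j < n\<close> by blast
    then have "A j *\<^sub>v z = l \<cdot>\<^sub>v z" using Ac[OF that] wc
      by (simp add: z_def mult_mat_vec[of _ d d] smult_smult_assoc mult.commute)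
    then show ?thesis by blast
  qed
  show ?case
    by (rule exI[of _ "e(k := z)"]) (use e ev on zc zz ze ez zev in \<open>auto simp: less_Suc_eq\<close>)
qed

text \<open>\<open>D\<close> is the adjoint of the matrix with the eigenvectors as columns, that is,
  the change into the eigenbasis that a circuit applies before measuring. Real eigenvalues
  \<open>g\<close> are what later turns exponentials into phases.\<close>

theorem simultaneous_diagonalization:
  fixes A :: "nat \<Rightarrow> complex mat"
  assumes A: "\<And>j. j < n \<Longrightarrow> hermitian_mat d (A j)"
    and comm: "\<And>i j. i < n \<Longrightarrow> j < n \<Longrightarrow> A i * A j = A j * A i"
  shows "\<exists>D g. unitary_mat d D \<and>
    (\<forall>j<n. A j = mat_adjoint D * mat_diag d (\<lambda>a. complex_of_real (g j a)) * D)"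
proof -
  obtain e where e: "\<And>i. i < d \<Longrightarrow> e i \<in> carrier_vec d"
    and ev: "\<And>i j. i < d \<Longrightarrow> j < n \<Longrightarrow> \<exists>\<mu>. A j *\<^sub>v e i = \<mu> \<cdot>\<^sub>v e i"
    and on: "\<And>i j. i < d \<Longrightarrow> j < d \<Longrightarrow> e i \<bullet>c e j = (if i = j then 1 else 0)"
    using orthonormal_common_eigenvectors[of n d A d, OF A comm order_refl] by blast
  have "\<forall>j i. \<exists>\<mu>. i < d \<longrightarrow> j < n \<longrightarrow> A j *\<^sub>v e i = \<mu> \<cdot>\<^sub>v e i" using ev by blast
  then obtain l where l: "\<And>i j. i < d \<Longrightarrow> j < n \<Longrightarrow> A j *\<^sub>v e i = l j i \<cdot>\<^sub>v e i" by metis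
  have Ac: "A j \<in> carrier_mat d d" if "j < n" for j using A[OF that] by (simp add: hermitian_mat_def)
  have real: "l j i = complex_of_real (Re (l j i))" if "i < d" "j < n" for i j
  proof -
    have "(l j i \<cdot>\<^sub>v e i) \<bullet>c e i = e i \<bullet>c (l j i \<cdot>\<^sub>v e i)"
      using hermitian_mat_inner[OF A[OF that(2)] e[OF that(1)] e[OF that(1)]] l that by simp
    then have "l j i = cnj (l j i)" using e[OF that(1)] on that by (simp add: conjugate_smult_vec)
    then show ?thesis by (metis Reals_cnj_iff of_real_Re)
  qed
  define E where "E = mat d d (\<lambda>(r, a). e a $ r)"
  have Ec: "E \<in> carrier_mat d d" by (simp add: E_def)
  have E_index: "E $$ (r, a) = e a $ r" if "r < d" "a < d" for r a using that by (simp add: E_def)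
  note Ea = mat_adjoint_carrier[OF Ec]
  have colE: "col E a = e a" if "a < d" for a
    using e[OF that] that by (auto simp: E_def intro!: eq_vecI)
  have "mat_adjoint E * E = 1\<^sub>m d"
  proof (rule eq_matI)
    fix i j assume "i < dim_row (1\<^sub>m d :: complex mat)" "j < dim_col (1\<^sub>m d :: complex mat)"
    then have ij: "i < d" "j < d" by auto
    have "row (mat_adjoint E) i = conjugate (e i)"
      using ij e[OF ij(1)] Ea by (intro eq_vecI) (auto simp: mat_adjoint_index[OF Ec] E_index)
    then have "(mat_adjoint E * E) $$ (i, j) = conjugate (e i) \<bullet> e j"
      using ij Ea Ec colE by simp
    also have "\<dots> = e j \<bullet>c e i" using e[OF ij(1)] e[OF ij(2)]
      by (metis carrier_vec_conjugate comm_scalar_prod)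
    finally show "(mat_adjoint E * E) $$ (i, j) = 1\<^sub>m d $$ (i, j)" using on ij by auto
  qed (use Ea Ec in auto)
  note aEE = this mat_mult_left_right_inverse[OF Ea Ec this]
  note aa = mat_adjoint_adjoint[OF Ec]
  have "unitary_mat d (mat_adjoint E)" unfolding unitary_mat_def aa using aEE Ea by auto
  moreover have "A j = mat_adjoint (mat_adjoint E) *
      mat_diag d (\<lambda>a. complex_of_real (Re (l j a))) * mat_adjoint E" if j: "j < n" for j
  proof -
    have "A j * E = E * mat_diag d (\<lambda>a. complex_of_real (Re (l j a)))"
      unfolding mat_diag_mult_right[OF Ec]
    proof (rule eq_matI)
      fix r a assume "r < dim_row (mat d d (\<lambda>(i, k). E $$ (i, k) * complex_of_real (Re (l j k))))"
        "a < dim_col (mat d d (\<lambda>(i, k). E $$ (i, k) * complex_of_real (Re (l j k))))"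
      then have ra: "r < d" "a < d" by auto
      have "(A j * E) $$ (r, a) = (A j *\<^sub>v col E a) $ r" using ra Ac[OF j] Ec by simp
      also have "\<dots> = l j a * e a $ r" using ra l[OF ra(2) j] carrier_vecD[OF e[OF ra(2)]] colE by auto
      finally show "(A j * E) $$ (r, a) =
          mat d d (\<lambda>(i, k). E $$ (i, k) * complex_of_real (Re (l j k))) $$ (r, a)"
        using ra real[OF ra(2) j] by (simp add: E_def)
    qed (use Ac[OF j] Ec in auto)
    then have "E * mat_diag d (\<lambda>a. complex_of_real (Re (l j a))) * mat_adjoint E =
        A j * (E * mat_adjoint E)"
      using assoc_mult_mat[OF Ac[OF j] Ec Ea] by simp
    then show ?thesis using aEE Ac[OF j] by (simp add: aa)
  qed
  ultimately show ?thesis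
    by (intro exI[of _ "mat_adjoint E"] exI[of _ "\<lambda>j a. Re (l j a)"]) auto
qed

section \<open>Commuting blocks as phases\<close>

lemma mat_adjoint_one [simp]: "mat_adjoint (1\<^sub>m d) = (1\<^sub>m d :: complex mat)"
  using carrier_matD[OF mat_adjoint_carrier[of "1\<^sub>m d" d d]]
  by (intro eq_matI) (auto simp: mat_adjoint_index[of _ d d])

lemma mat_adjoint_zero [simp]: "mat_adjoint (0\<^sub>m d d) = (0\<^sub>m d d :: complex mat)"
  using carrier_matD[OF mat_adjoint_carrier[of "0\<^sub>m d d" d d]]
  by (intro eq_matI) (auto simp: mat_adjoint_index[of _ d d])

lemma dim_mat_diag [simp]: "dim_row (mat_diag d f) = d" "dim_col (mat_diag d f) = d"
  by (simp_all add: mat_diag_def)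

lemma mat_adjoint_diag [simp]:
  "mat_adjoint (mat_diag d f) = mat_diag d (\<lambda>a. cnj (f a))"
  using carrier_matD[OF mat_adjoint_carrier[OF mat_diag_dim[of d f]]]
  by (intro eq_matI) (auto simp: mat_adjoint_index[of _ d d] mat_diag_def)

lemma unitary_matD:
  assumes "unitary_mat d D"
  shows "D \<in> carrier_mat d d" "mat_adjoint D \<in> carrier_mat d d"
    "D * mat_adjoint D = 1\<^sub>m d" "mat_adjoint D * D = 1\<^sub>m d"
  using assms mat_adjoint_carrier[of D d d] by (auto simp: unitary_mat_def)

lemma unitary_matI:
  assumes "A \<in> carrier_mat d d" "A * mat_adjoint A = 1\<^sub>m d"
  shows "unitary_mat d A"
  using assms mat_mult_left_right_inverse[OF assms(1) mat_adjoint_carrier[OF assms(1)]]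
  by (simp add: unitary_mat_def)

lemma unitary_mat_one: "unitary_mat d (1\<^sub>m d)"
  by (simp add: unitary_mat_def)

lemma unitary_mat_adjoint:
  assumes "unitary_mat d A"
  shows "unitary_mat d (mat_adjoint A)"
  using unitary_matD[OF assms] by (simp add: unitary_mat_def mat_adjoint_adjoint)

lemma mult_cancel_middle:
  assumes "A \<in> carrier_mat d d" "X \<in> carrier_mat d d" "Y \<in> carrier_mat d d" "C \<in> carrier_mat d d"
    and "X * Y = 1\<^sub>m d"
  shows "(A * X) * (Y * C) = A * (C :: complex mat)"
proof -
  have "(A * X) * (Y * C) = A * (X * (Y * C))" using assms by (intro assoc_mult_mat) auto
  also have "X * (Y * C) = (X * Y) * C" using assms by (intro assoc_mult_mat[symmetric]) auto
  finally show ?thesis using assms by simp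
qed

lemma unitary_mat_mult:
  assumes "unitary_mat d A" "unitary_mat d B"
  shows "unitary_mat d (A * B)"
proof -
  note A = unitary_matD[OF assms(1)] and B = unitary_matD[OF assms(2)]
  have "(A * B) * (mat_adjoint B * mat_adjoint A) = A * mat_adjoint A"
    using A B by (intro mult_cancel_middle) auto
  then show ?thesis
    using A B by (intro unitary_matI) (auto simp: mat_adjoint_mult[OF A(1) B(1)])
qed

lemma unitary_mat_diag:
  assumes "\<And>a. a < d \<Longrightarrow> cmod (f a) = 1"
  shows "unitary_mat d (mat_diag d f)"
proof (rule unitary_matI)
  have "mat_diag d (\<lambda>a. f a * cnj (f a)) = mat_diag d (\<lambda>_. 1)"
    using assms by (intro eq_matI) (auto simp: mat_diag_def complex_norm_square[symmetric])
  then show "mat_diag d f * mat_adjoint (mat_diag d f) = 1\<^sub>m d" by simp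
qed simp

lemma mult_mat_diag_mult_index:
  assumes "X \<in> carrier_mat m d" "Y \<in> carrier_mat d l" "i < m" "j < l"
  shows "(X * mat_diag d f * Y) $$ (i, j) = (\<Sum>a<d. X $$ (i, a) * f a * (Y $$ (a, j) :: complex))"
  using assms by (simp add: mat_diag_mult_right[OF assms(1)] scalar_prod_def lessThan_atLeast0)

text \<open>The inner \<open>D * mat_adjoint D\<close> cancels. Thus passing from \<open>f\<close>
  to \<open>mat_adjoint D * mat_diag d f * D\<close> is multiplicative, and powers and ordered
  products reduce to pointwise operations on \<open>f\<close>.\<close>

lemma diagonalized_mult:
  assumes "unitary_mat d D"
  shows "(mat_adjoint D * mat_diag d f * D) * (mat_adjoint D * mat_diag d g * D) =
    mat_adjoint D * mat_diag d (\<lambda>a. f a * g a) * D"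
proof -
  note D = unitary_matD[OF assms]
  have mD: "mat_diag d h * D \<in> carrier_mat d d" for h
    by (rule mult_carrier_mat[OF mat_diag_dim D(1)])
  have "(mat_adjoint D * mat_diag d f * D) * (mat_adjoint D * mat_diag d g * D) =
      (mat_adjoint D * mat_diag d f * D) * (mat_adjoint D * (mat_diag d g * D))"
    using D mD by (subst assoc_mult_mat[of "mat_adjoint D" d d _ d _ d]) auto
  also have "\<dots> = mat_adjoint D * mat_diag d f * (mat_diag d g * D)"
    using D mD by (intro mult_cancel_middle) auto
  also have "\<dots> = mat_adjoint D * mat_diag d f * mat_diag d g * D"
    using D by (intro assoc_mult_mat[symmetric]) auto
  also have "mat_adjoint D * mat_diag d f * mat_diag d g = mat_adjoint D * (mat_diag d f * mat_diag d g)"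
    using D by (intro assoc_mult_mat) auto
  finally show ?thesis by simp
qed

lemma diagonalized_one:
  assumes "unitary_mat d D"
  shows "mat_adjoint D * mat_diag d (\<lambda>_. 1) * D = 1\<^sub>m d"
  using unitary_matD[OF assms] by simp

lemma diagonalized_power:
  assumes "unitary_mat d D"
  shows "(mat_adjoint D * mat_diag d f * D) ^\<^sub>m k = mat_adjoint D * mat_diag d (\<lambda>a. f a ^ k) * D"
proof (induction k)
  case 0
  have "dim_row (mat_adjoint D) = d" using unitary_matD[OF assms] by simp
  then show ?case using diagonalized_one[OF assms] by simp
next
  case (Suc k)
  then show ?case using diagonalized_mult[OF assms, of "\<lambda>a. f a ^ k" f] by (simp add: mult.commute)
qed

text \<open>Each entry of the matrix series is a fixed finite combination of scalar exponential
  series. Arguing with \<open>sums\<close> also supplies the convergence without which the entrywise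
  infinite sum in \<open>mat_exp\<close> has no usable value.\<close>

lemma mat_exp_diagonalized:
  assumes "unitary_mat d D"
  shows "mat_exp (mat_adjoint D * mat_diag d f * D) = mat_adjoint D * mat_diag d (\<lambda>a. exp (f a)) * D"
proof (rule eq_matI)
  note D = unitary_matD[OF assms]
  have dim: "dim_row (mat_adjoint D) = d" "dim_col D = d" using D by simp_all
  fix i j assume "i < dim_row (mat_adjoint D * mat_diag d (\<lambda>a. exp (f a)) * D)"
    "j < dim_col (mat_adjoint D * mat_diag d (\<lambda>a. exp (f a)) * D)"
  then have ij: "i < d" "j < d" using dim by auto
  let ?c = "\<lambda>a. mat_adjoint D $$ (i, a) * D $$ (a, j)"
  have s: "(\<lambda>k. ?c a * (f a ^ k /\<^sub>R fact k)) sums (?c a * exp (f a))" for a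
    by (intro sums_mult exp_converges)
  have "(\<lambda>k. \<Sum>a<d. ?c a * (f a ^ k /\<^sub>R fact k)) sums (\<Sum>a<d. ?c a * exp (f a))"
    by (intro sums_sum s)
  moreover have "(\<Sum>a<d. ?c a * (f a ^ k /\<^sub>R fact k)) =
      ((mat_adjoint D * mat_diag d f * D) ^\<^sub>m k) $$ (i, j) / fact k" for k
    using ij unfolding diagonalized_power[OF assms] mult_mat_diag_mult_index[OF D(2,1) ij]
    by (simp add: sum_divide_distrib scaleR_conv_of_real field_simps)
  ultimately have "(\<lambda>k. ((mat_adjoint D * mat_diag d f * D) ^\<^sub>m k) $$ (i, j) / fact k) sums
      (\<Sum>a<d. ?c a * exp (f a))" by simp
  then have "(\<Sum>k. ((mat_adjoint D * mat_diag d f * D) ^\<^sub>m k) $$ (i, j) / fact k) =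
      (\<Sum>a<d. ?c a * exp (f a))" by (rule sums_unique[symmetric])
  also have "\<dots> = (mat_adjoint D * mat_diag d (\<lambda>a. exp (f a)) * D) $$ (i, j)"
    unfolding mult_mat_diag_mult_index[OF D(2,1) ij] by (simp add: mult_ac)
  finally show "mat_exp (mat_adjoint D * mat_diag d f * D) $$ (i, j) =
      (mat_adjoint D * mat_diag d (\<lambda>a. exp (f a)) * D) $$ (i, j)"
    using ij dim by (simp add: mat_exp_def)
qed (use unitary_matD[OF assms] in \<open>auto simp: mat_exp_def\<close>)

lemma smult_diagonalized:
  assumes "unitary_mat d D"
  shows "c \<cdot>\<^sub>m (mat_adjoint D * mat_diag d f * D) = mat_adjoint D * mat_diag d (\<lambda>a. c * f a) * D"
proof (rule eq_matI)
  note D = unitary_matD[OF assms]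
  fix i j assume "i < dim_row (mat_adjoint D * mat_diag d (\<lambda>a. c * f a) * D)"
    "j < dim_col (mat_adjoint D * mat_diag d (\<lambda>a. c * f a) * D)"
  then have ij: "i < d" "j < d" using D by auto
  then have "(c \<cdot>\<^sub>m (mat_adjoint D * mat_diag d f * D)) $$ (i, j) =
      c * (mat_adjoint D * mat_diag d f * D) $$ (i, j)" using D by simp
  then show "(c \<cdot>\<^sub>m (mat_adjoint D * mat_diag d f * D)) $$ (i, j) =
      (mat_adjoint D * mat_diag d (\<lambda>a. c * f a) * D) $$ (i, j)"
    unfolding mult_mat_diag_mult_index[OF D(2,1) ij] by (simp add: sum_distrib_left mult_ac)
qed (use unitary_matD[OF assms] in auto)

section \<open>Ordered products of gates and blocks\<close>

lemma mat_list_prod_append: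
  assumes "\<And>A. A \<in> set As \<union> set Bs \<Longrightarrow> A \<in> carrier_mat d d"
  shows "mat_list_prod d (As @ Bs) = mat_list_prod d As * mat_list_prod d Bs \<and>
    mat_list_prod d As \<in> carrier_mat d d \<and> mat_list_prod d Bs \<in> carrier_mat d d"
proof -
  have c: "mat_list_prod d Cs \<in> carrier_mat d d" if "set Cs \<subseteq> carrier_mat d d" for Cs
    using that by (induction Cs) (auto simp: mat_list_prod_def)
  have "mat_list_prod d (As @ Bs) = mat_list_prod d As * mat_list_prod d Bs"
    using assms
  proof (induction As)
    case Nil
    then show ?case using c[of Bs] by (simp add: mat_list_prod_def subset_iff)
  next
    case (Cons A As)
    then have "A \<in> carrier_mat d d" "mat_list_prod d As \<in> carrier_mat d d"
      "mat_list_prod d Bs \<in> carrier_mat d d" using c[of As] c[of Bs] by auto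
    from assoc_mult_mat[OF this] Cons show ?case by (simp add: mat_list_prod_def)
  qed
  then show ?thesis using c[of As] c[of Bs] assms by auto
qed

lemma unitary_mat_list_prod:
  assumes "\<And>A. A \<in> set As \<Longrightarrow> unitary_mat d A"
  shows "unitary_mat d (mat_list_prod d As)"
  using assms by (induction As) (auto simp: mat_list_prod_def unitary_mat_one intro: unitary_mat_mult)

lemma mat_list_prod_diagonalized:
  assumes "unitary_mat d D"
  shows "mat_list_prod d (map (\<lambda>j. mat_adjoint D * mat_diag d (f j) * D) js) =
    mat_adjoint D * mat_diag d (\<lambda>a. \<Prod>j\<leftarrow>js. f j a) * D"
proof (induction js)
  case Nil
  then show ?case using diagonalized_one[OF assms] by (simp add: mat_list_prod_def)
next
  case (Cons j js)
  then show ?case using diagonalized_mult[OF assms, of "f j"] by (simp add: mat_list_prod_def)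
qed

lemma commuting_block_diagonalized:
  assumes D: "unitary_mat d D"
    and G: "\<And>j. j < N \<Longrightarrow> G j = mat_adjoint D * mat_diag d (\<lambda>a. complex_of_real (g j a)) * D"
  shows "mat_list_prod d (map (\<lambda>j. mat_exp ((\<i> * complex_of_real (\<theta> j)) \<cdot>\<^sub>m G j)) [0..<N]) =
    mat_adjoint D * mat_diag d (\<lambda>a. cis (\<Sum>j<N. \<theta> j * g j a)) * D"
proof -
  have "map (\<lambda>j. mat_exp ((\<i> * complex_of_real (\<theta> j)) \<cdot>\<^sub>m G j)) [0..<N] =
      map (\<lambda>j. mat_adjoint D * mat_diag d (\<lambda>a. cis (\<theta> j * g j a)) * D) [0..<N]"
    by (auto simp: G smult_diagonalized[OF D] mat_exp_diagonalized[OF D] cis_conv_exp mult.assoc)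
  moreover have "(\<Prod>j\<leftarrow>[0..<m]. cis (\<theta> j * g j a)) = cis (\<Sum>j<m. \<theta> j * g j a)" for a m
    by (induction m) (simp_all add: cis_mult)
  ultimately show ?thesis by (simp only: mat_list_prod_diagonalized[OF D])
qed

lemma commuting_block_unitary:
  assumes "\<And>j. j < N \<Longrightarrow> hermitian_mat d (G j)"
    and "\<And>i j. i < N \<Longrightarrow> j < N \<Longrightarrow> G i * G j = G j * G i"
  shows "unitary_mat d (mat_list_prod d (map (\<lambda>j. mat_exp ((\<i> * complex_of_real (\<theta> j)) \<cdot>\<^sub>m G j)) [0..<N]))"
proof -
  obtain D g where D: "unitary_mat d D"
    and G: "\<And>j. j < N \<Longrightarrow> G j = mat_adjoint D * mat_diag d (\<lambda>a. complex_of_real (g j a)) * D"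
    using simultaneous_diagonalization[of N d G, OF assms] by auto
  have "mat_list_prod d (map (\<lambda>j. mat_exp ((\<i> * complex_of_real (\<theta> j)) \<cdot>\<^sub>m G j)) [0..<N]) =
      mat_adjoint D * mat_diag d (\<lambda>a. cis (\<Sum>j<N. \<theta> j * g j a)) * D"
    by (rule commuting_block_diagonalized[OF D]) (rule G)
  moreover have "unitary_mat d (mat_adjoint D * mat_diag d (\<lambda>a. cis (\<Sum>j<N. \<theta> j * g j a)) * D)"
    by (intro unitary_mat_mult unitary_mat_adjoint D unitary_mat_diag) simp
  ultimately show ?thesis by (simp only:)
qed

text \<open>\<open>X\<close> and \<open>F\<close> depend neither on \<open>j\<close> nor on
  \<open>t\<close>; this is why the same circuits serve all parameters of a block. \<open>F\<close>
  contains the blocks acting before block \<open>b\<close> and block \<open>b\<close> itself at the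
  current \<open>\<theta>\<close>, so the remaining phases are trivial at
  \<open>t = \<theta> b j\<close>.\<close>

lemma commuting_block_circuit_param:
  assumes circ: "commuting_block_circuit d B N G U" and b: "b < B"
  shows "\<exists>X F g. unitary_mat d X \<and> unitary_mat d F \<and>
    (\<forall>j<N b. \<forall>t. U (\<theta>(b := (\<theta> b)(j := t))) =
       mat_adjoint X * mat_diag d (\<lambda>a. cis ((t - \<theta> b j) * g j a)) * F)"
proof -
  have herm: "\<And>b j. b < B \<Longrightarrow> j < N b \<Longrightarrow> hermitian_mat d (G b j)"
    and comm: "\<And>b i j. b < B \<Longrightarrow> i < N b \<Longrightarrow> j < N b \<Longrightarrow> G b i * G b j = G b j * G b i"
    and U: "\<And>\<theta>. U \<theta> = block_circuit d B N G \<theta>"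
    using circ by (auto simp: commuting_block_circuit_def)
  define blk where "blk \<theta> b =
    mat_list_prod d (map (\<lambda>j. mat_exp ((\<i> * complex_of_real (\<theta> b j)) \<cdot>\<^sub>m G b j)) [0..<N b])"
    for \<theta> :: "nat \<Rightarrow> nat \<Rightarrow> real" and b
  have U_blk: "U \<theta> = mat_list_prod d (map (blk \<theta>) [0..<B])" for \<theta>
    by (simp add: U block_circuit_def blk_def[abs_def])
  have blk_unitary: "unitary_mat d (blk \<theta> b)" if "b < B" for \<theta> b
    unfolding blk_def by (intro commuting_block_unitary herm comm that)
  obtain D g where D: "unitary_mat d D"
    and G: "\<And>j. j < N b \<Longrightarrow> G b j = mat_adjoint D * mat_diag d (\<lambda>a. complex_of_real (g j a)) * D"
    using simultaneous_diagonalization[of "N b" d "G b", OF herm[OF b] comm[OF b]] by auto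
  \<comment> \<open>Factors on the left act last: \<open>P\<close> collects the blocks applied after
    block \<open>b\<close>, and \<open>S\<close> those applied before it.\<close>
  define P where "P = mat_list_prod d (map (blk \<theta>) [0..<b])"
  define S where "S = mat_list_prod d (map (blk \<theta>) [Suc b..<B])"
  have P: "unitary_mat d P" and S: "unitary_mat d S"
    unfolding P_def S_def using b by (auto intro!: unitary_mat_list_prod blk_unitary)
  define \<phi> where "\<phi> a = (\<Sum>j<N b. \<theta> b j * g j a)" for a
  define E where "E = mat_diag d (\<lambda>a. cis (\<phi> a))"
  have E: "unitary_mat d E" unfolding E_def by (intro unitary_mat_diag) simp
  define X where "X = D * mat_adjoint P"
  define F where "F = E * (D * S)"
  have X: "unitary_mat d X" unfolding X_def by (intro unitary_mat_mult unitary_mat_adjoint D P)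
  have F: "unitary_mat d F" unfolding F_def by (intro unitary_mat_mult E D S)
  note c = unitary_matD(1,2)[OF D] unitary_matD(1,2)[OF P] unitary_matD(1)[OF S]
    unitary_matD(1)[OF E]
  have Xa: "mat_adjoint X = P * mat_adjoint D"
    using mat_adjoint_mult[OF c(1) c(4)] mat_adjoint_adjoint[OF c(3)] by (simp add: X_def)
  have "U (\<theta>(b := (\<theta> b)(j := t))) =
      mat_adjoint X * mat_diag d (\<lambda>a. cis ((t - \<theta> b j) * g j a)) * F" if j: "j < N b" for j t
  proof -
    let ?\<theta> = "\<theta>(b := (\<theta> b)(j := t))" and ?E = "mat_diag d (\<lambda>a. cis ((t - \<theta> b j) * g j a))"
    have "[0..<B] = [0..<b] @ [b] @ [Suc b..<B]"
      using b upt_add_eq_append[of 0 b "B - b"] upt_conv_Cons[of b B] by simp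
    moreover have "map (blk ?\<theta>) [0..<b] = map (blk \<theta>) [0..<b]"
      "map (blk ?\<theta>) [Suc b..<B] = map (blk \<theta>) [Suc b..<B]"
      by (auto simp: blk_def)
    ultimately have "U ?\<theta> = mat_list_prod d (map (blk \<theta>) [0..<b] @ [blk ?\<theta> b] @ map (blk \<theta>) [Suc b..<B])"
      by (simp only: U_blk map_append list.map)
    also have "\<dots> = P * (blk ?\<theta> b * S)"
      using b blk_unitary
      by (subst mat_list_prod_append) (auto simp: unitary_mat_def P_def S_def mat_list_prod_def)
    also have "blk ?\<theta> b = mat_adjoint D * mat_diag d (\<lambda>a. cis (\<Sum>i<N b. ?\<theta> b i * g i a)) * D"
      unfolding blk_def by (rule commuting_block_diagonalized[OF D]) (rule G)
    also have "(\<lambda>a. cis (\<Sum>i<N b. ?\<theta> b i * g i a)) = (\<lambda>a. cis ((t - \<theta> b j) * g j a) * cis (\<phi> a))"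
    proof
      fix a
      \<comment> \<open>Phases are linear in the parameters, so changing coordinate \<open>j\<close>
        adds \<open>(t - \<theta> b j) * g j a\<close> to the current phase
        \<open>\<phi> a\<close>.\<close>
      have "(\<Sum>i<N b. ?\<theta> b i * g i a) = (\<Sum>i<N b. (if i = j then (t - \<theta> b j) * g j a else 0) + \<theta> b i * g i a)"
        by (intro sum.cong) (auto simp: algebra_simps)
      also have "\<dots> = (t - \<theta> b j) * g j a + \<phi> a"
        using j by (simp add: sum.distrib \<phi>_def)
      finally show "cis (\<Sum>i<N b. ?\<theta> b i * g i a) = cis ((t - \<theta> b j) * g j a) * cis (\<phi> a)"
        by (simp add: cis_mult)
    qed
    also have "mat_diag d (\<lambda>a. cis ((t - \<theta> b j) * g j a) * cis (\<phi> a)) = ?E * E"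
      by (simp add: E_def)
    also have "P * (mat_adjoint D * (?E * E) * D * S) = mat_adjoint X * ?E * F"
    proof -
      have Ec: "?E \<in> carrier_mat d d" by simp
      have "mat_adjoint D * (?E * E) * D * S = mat_adjoint D * (?E * E) * (D * S)"
        using c Ec by (intro assoc_mult_mat[of _ d d _ d _ d]) auto
      also have "\<dots> = mat_adjoint D * ((?E * E) * (D * S))"
        using c Ec by (intro assoc_mult_mat[of _ d d _ d _ d]) auto
      also have "(?E * E) * (D * S) = ?E * F"
        unfolding F_def using c Ec by (intro assoc_mult_mat[of _ d d _ d _ d]) auto
      finally have "P * (mat_adjoint D * (?E * E) * D * S) = P * (mat_adjoint D * (?E * F))" by simp
      also have "\<dots> = P * mat_adjoint D * (?E * F)"
        using c Ec unitary_matD(1)[OF F] by (intro assoc_mult_mat[of _ d d _ d _ d, symmetric]) auto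
      also have "\<dots> = P * mat_adjoint D * ?E * F"
        using c Ec unitary_matD(1)[OF F] by (intro assoc_mult_mat[of _ d d _ d _ d, symmetric]) auto
      finally show ?thesis by (simp add: Xa)
    qed
    finally show ?thesis .
  qed
  then show ?thesis using X F by blast
qed

section \<open>Derivative of the loss\<close>

text \<open>Cyclicity of the trace moves \<open>X\<close> onto the observable, leaving the diagonal
  phases to conjugate the state \<open>F * R * mat_adjoint F\<close>; this multiplies its entry
  \<open>(a, b)\<close> by \<open>f a * cnj (f b)\<close>.\<close>

lemma mat_trace_phase_conjugation:
  assumes X: "X \<in> carrier_mat d d" and F: "F \<in> carrier_mat d d"
    and H: "H \<in> carrier_mat d d" and R: "R \<in> carrier_mat d d"
    and V: "V = mat_adjoint X * mat_diag d f * F"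
  shows "mat_trace (H * (V * R * mat_adjoint V)) =
    (\<Sum>a<d. \<Sum>b<d. (F * R * mat_adjoint F) $$ (a, b) * (X * H * mat_adjoint X) $$ (b, a) *
      (f a * cnj (f b)))"
proof -
  define E where "E = mat_diag d f"
  define \<sigma> where "\<sigma> = F * R * mat_adjoint F"
  define K where "K = X * H * mat_adjoint X"
  note Xa = mat_adjoint_carrier[OF X] and Fa = mat_adjoint_carrier[OF F]
  have E: "E \<in> carrier_mat d d" by (simp add: E_def)
  note Ea = mat_adjoint_carrier[OF E]
  have \<sigma>: "\<sigma> \<in> carrier_mat d d" using F R Fa by (simp add: \<sigma>_def)
  have K: "K \<in> carrier_mat d d" using X H Xa by (simp add: K_def)
  have EF: "E * F \<in> carrier_mat d d" using E F by simp
  have Va: "mat_adjoint V = mat_adjoint F * (mat_adjoint E * X)"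
    using X F E Xa Ea Fa
    by (simp add: V E_def[symmetric] mat_adjoint_mult[of _ d d _ d] mat_adjoint_adjoint[OF X])
  note as = assoc_mult_mat[of _ d d _ d _ d]
  have "V * R * mat_adjoint V = mat_adjoint X * (E * \<sigma> * mat_adjoint E * X)"
    using X F R E Xa Ea Fa unfolding Va
    by (simp add: V E_def[symmetric] \<sigma>_def as mult_carrier_mat[of _ d d _ d])
  then have "mat_trace (H * (V * R * mat_adjoint V)) =
      mat_trace (H * mat_adjoint X * (E * \<sigma> * mat_adjoint E * X))"
    using X H E Xa Ea \<sigma> by (simp add: as mult_carrier_mat[of _ d d _ d])
  also have "\<dots> = mat_trace (E * \<sigma> * mat_adjoint E * X * (H * mat_adjoint X))"
    using X H E Xa Ea \<sigma> by (intro mat_trace_comm) auto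
  also have "E * \<sigma> * mat_adjoint E * X * (H * mat_adjoint X) = E * \<sigma> * mat_adjoint E * K"
    using X H E Xa Ea \<sigma> by (simp add: K_def as mult_carrier_mat[of _ d d _ d])
  also have "mat_trace \<dots> = (\<Sum>a<d. \<Sum>b<d. (E * \<sigma> * mat_adjoint E) $$ (a, b) * K $$ (b, a))"
    using E Ea \<sigma> K by (simp add: mat_trace_def scalar_prod_def lessThan_atLeast0)
  also have "\<dots> = (\<Sum>a<d. \<Sum>b<d. \<sigma> $$ (a, b) * K $$ (b, a) * (f a * cnj (f b)))"
  proof (intro sum.cong refl)
    fix a b assume "a \<in> {..<d}" "b \<in> {..<d}"
    then show "(E * \<sigma> * mat_adjoint E) $$ (a, b) * K $$ (b, a) =
        \<sigma> $$ (a, b) * K $$ (b, a) * (f a * cnj (f b))"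
      by (simp add: E_def mat_diag_mult_left[OF \<sigma>] mat_diag_mult_right[of _ d])
  qed
  finally show ?thesis by (simp add: \<sigma>_def K_def)
qed

lemma hermitian_matD:
  assumes "hermitian_mat d A"
  shows "A \<in> carrier_mat d d" "mat_adjoint A = A"
    "\<And>i j. i < d \<Longrightarrow> j < d \<Longrightarrow> cnj (A $$ (i, j)) = A $$ (j, i)"
proof -
  show *: "A \<in> carrier_mat d d" "mat_adjoint A = A" using assms by (simp_all add: hermitian_mat_def)
  show "cnj (A $$ (i, j)) = A $$ (j, i)" if "i < d" "j < d" for i j
    using mat_adjoint_index[OF *(1) that(2,1)] unfolding *(2) by (rule sym)
qed

lemma hermitian_mat_conjugate:
  assumes "hermitian_mat d R" and F: "F \<in> carrier_mat d d"
  shows "hermitian_mat d (F * R * mat_adjoint F)"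
proof -
  note R = hermitian_matD[OF assms(1)] and Fa = mat_adjoint_carrier[OF F]
  have "mat_adjoint (F * R * mat_adjoint F) = F * (R * mat_adjoint F)"
    using F R(1,2) Fa by (simp add: mat_adjoint_mult[of _ d d _ d] mat_adjoint_adjoint[OF F])
  then show ?thesis using F R Fa by (simp add: hermitian_mat_def)
qed

text \<open>At \<open>t0\<close>, the real part of
  \<open>z a b * cis ((t - t0) * (g a - g b))\<close> has derivative
  \<open>- Im (z a b) * (g a - g b)\<close>. Since \<open>z\<close> is a Hermitian array,
  \<open>Im (z a b)\<close> is antisymmetric, so the \<open>g a\<close> and \<open>g b\<close> parts
  contribute equally; hence the factor 2, and the sum over \<open>b\<close> becomes a diagonal entry
  of a matrix product.\<close>

lemma has_real_derivative_phase_trace: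
  assumes X: "X \<in> carrier_mat d d" and F: "F \<in> carrier_mat d d"
    and H: "hermitian_mat d H" and R: "hermitian_mat d R"
    and V: "\<And>t. V t = mat_adjoint X * mat_diag d (\<lambda>a. cis ((t - t0) * g a)) * F"
  shows "((\<lambda>t. Re (mat_trace (H * (V t * R * mat_adjoint (V t))))) has_real_derivative
    - 2 * (\<Sum>a<d. g a * Im ((F * R * mat_adjoint F * (X * H * mat_adjoint X)) $$ (a, a)))) (at t0)"
proof -
  define \<sigma> where "\<sigma> = F * R * mat_adjoint F"
  define K where "K = X * H * mat_adjoint X"
  have \<sigma>: "hermitian_mat d \<sigma>" and K: "hermitian_mat d K"
    unfolding \<sigma>_def K_def using hermitian_mat_conjugate assms by blast+
  note \<sigma>D = hermitian_matD[OF \<sigma>] and KD = hermitian_matD[OF K]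
  define z where "z a b = \<sigma> $$ (a, b) * K $$ (b, a)" for a b
  have z_swap: "z b a = cnj (z a b)" if "a < d" "b < d" for a b
    using that by (simp add: z_def \<sigma>D KD)
  have phase: "cis ((t - t0) * g a) * cnj (cis ((t - t0) * g b)) = cis ((t - t0) * (g a - g b))"
    for t a b by (simp add: cis_cnj cis_mult algebra_simps)
  have "Re (mat_trace (H * (V t * R * mat_adjoint (V t)))) =
      (\<Sum>a<d. \<Sum>b<d. Re (z a b * cis ((t - t0) * (g a - g b))))" for t
    using mat_trace_phase_conjugation[OF X F hermitian_matD(1)[OF H] hermitian_matD(1)[OF R] V, of t]
    by (simp only: phase z_def \<sigma>_def K_def Re_sum)
  moreover have "((\<lambda>t. \<Sum>a<d. \<Sum>b<d. Re (z a b * cis ((t - t0) * (g a - g b)))) has_real_derivative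
      (\<Sum>a<d. \<Sum>b<d. - Im (z a b) * (g a - g b))) (at t0)"
    by (intro DERIV_sum) (auto intro!: derivative_eq_intros)
  moreover have "(\<Sum>a<d. \<Sum>b<d. - Im (z a b) * (g a - g b)) =
      - 2 * (\<Sum>a<d. g a * Im ((\<sigma> * K) $$ (a, a)))"
  proof -
    have "(\<Sum>a<d. \<Sum>b<d. Im (z a b) * g b) = (\<Sum>b<d. \<Sum>a<d. Im (z a b) * g b)"
      by (rule sum.swap)
    also have "\<dots> = (\<Sum>b<d. \<Sum>a<d. - Im (z b a) * g b)"
    proof (intro sum.cong refl)
      fix b a assume "b \<in> {..<d}" "a \<in> {..<d}"
      then show "Im (z a b) * g b = - Im (z b a) * g b" using z_swap[of a b] by simp
    qed
    finally have "(\<Sum>a<d. \<Sum>b<d. - Im (z a b) * (g a - g b)) = - 2 * (\<Sum>a<d. \<Sum>b<d. g a * Im (z a b))"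
      by (simp add: algebra_simps sum.distrib sum_subtractf sum_negf)
    also have "(\<Sum>a<d. \<Sum>b<d. g a * Im (z a b)) = (\<Sum>a<d. g a * Im ((\<sigma> * K) $$ (a, a)))"
      using \<sigma>D(1) KD(1)
      by (intro sum.cong refl) (simp add: z_def scalar_prod_def sum_distrib_left sum.distrib distrib_left lessThan_atLeast0)
    finally show ?thesis .
  qed
  ultimately show ?thesis by (simp add: \<sigma>_def K_def)
qed

text \<open>An eigenvalue \<open>c * x\<close> with \<open>\<bar>x\<bar> \<le> 1\<close> is the mean of the two phases \<open>c * cis (\<plusminus> arccos x)\<close>.\<close>

lemma hermitian_mat_eq_unitary_mean:
  assumes "hermitian_mat d H"
  shows "\<exists>c W. unitary_mat d W \<and> H = complex_of_real (c / 2) \<cdot>\<^sub>m (W + mat_adjoint W)"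
proof -
  obtain D and g :: "nat \<Rightarrow> nat \<Rightarrow> real" where D: "unitary_mat d D"
    and Hj: "\<forall>j<1. H = mat_adjoint D * mat_diag d (\<lambda>a. complex_of_real (g j a)) * D"
    using simultaneous_diagonalization[of 1 d "\<lambda>_. H", OF assms refl] by blast
  have HD: "H = mat_adjoint D * mat_diag d (\<lambda>a. complex_of_real (g 0 a)) * D"
    by (rule Hj[rule_format]) simp
  note Dc = unitary_matD[OF D]
  \<comment> \<open>The sum dominates every eigenvalue in absolute value, and the summand 1 keeps
    \<open>c\<close> positive even for the zero matrix.\<close>
  define c where "c = 1 + (\<Sum>a<d. \<bar>g 0 a\<bar>)"
  define x where "x a = g 0 a / c" for a
  define \<phi> where "\<phi> a = cis (arccos (x a))" for a
  define W where "W = mat_adjoint D * mat_diag d \<phi> * D"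
  have c: "c > 0" by (auto simp: c_def intro!: add_pos_nonneg sum_nonneg)
  have x: "cos (arccos (x a)) = x a" if "a < d" for a
  proof -
    have "\<bar>g 0 a\<bar> \<le> (\<Sum>a<d. \<bar>g 0 a\<bar>)" using that by (intro member_le_sum) auto
    then have "\<bar>x a\<bar> \<le> 1" using c by (simp add: x_def c_def)
    then show ?thesis by (intro cos_arccos_abs)
  qed
  have W: "unitary_mat d W"
    unfolding W_def by (intro unitary_mat_mult unitary_mat_adjoint D unitary_mat_diag) (simp add: \<phi>_def)
  have "mat_adjoint W = mat_adjoint D * (mat_diag d (\<lambda>a. cnj (\<phi> a)) * D)"
    using Dc by (simp add: W_def mat_adjoint_mult[of _ d d _ d] mat_adjoint_adjoint)
  then have Wa: "mat_adjoint W = mat_adjoint D * mat_diag d (\<lambda>a. cnj (\<phi> a)) * D"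
    using Dc assoc_mult_mat[OF Dc(2) mat_diag_dim Dc(1)] by simp
  have "H = complex_of_real (c / 2) \<cdot>\<^sub>m (W + mat_adjoint W)"
  proof (rule eq_matI)
    fix i j assume "i < dim_row (complex_of_real (c / 2) \<cdot>\<^sub>m (W + mat_adjoint W))"
      "j < dim_col (complex_of_real (c / 2) \<cdot>\<^sub>m (W + mat_adjoint W))"
    then have ij: "i < d" "j < d" using unitary_matD[OF W] by auto
    have "complex_of_real (c / 2) * (W $$ (i, j) + mat_adjoint W $$ (i, j)) =
        (\<Sum>a<d. mat_adjoint D $$ (i, a) * (complex_of_real (c / 2) * (\<phi> a + cnj (\<phi> a))) * D $$ (a, j))"
      unfolding Wa unfolding W_def mult_mat_diag_mult_index[OF Dc(2,1) ij]
      by (simp add: sum_distrib_left sum.distrib algebra_simps add_divide_distrib)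
    also have "\<dots> = (\<Sum>a<d. mat_adjoint D $$ (i, a) * complex_of_real (g 0 a) * D $$ (a, j))"
    proof (intro sum.cong refl arg_cong2[where f = "(*)"])
      fix a assume "a \<in> {..<d}"
      then show "complex_of_real (c / 2) * (\<phi> a + cnj (\<phi> a)) = complex_of_real (g 0 a)"
        using x[of a] c by (simp add: complex_eq_iff \<phi>_def) (simp add: x_def)
    qed
    also have "\<dots> = H $$ (i, j)"
      unfolding HD mult_mat_diag_mult_index[OF Dc(2,1) ij] by simp
    finally show "H $$ (i, j) = (complex_of_real (c / 2) \<cdot>\<^sub>m (W + mat_adjoint W)) $$ (i, j)"
      using ij unitary_matD[OF W] by simp
  qed (use unitary_matD[OF W] hermitian_matD[OF assms] in auto)
  then show ?thesis using W by blast
qed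

section \<open>Hadamard tests\<close>

text \<open>For \<open>z = \<i>\<close> and \<open>z = - \<i>\<close> this is the operator on the
  data register belonging to ancilla outcome 0 and 1: the branch on which \<open>T\<close> has acted
  interferes with the untouched branch carrying the phase \<open>z\<close>.\<close>

definition shifted_half :: "nat \<Rightarrow> complex \<Rightarrow> complex mat \<Rightarrow> complex mat" where
  "shifted_half d z T = (1 / 2) \<cdot>\<^sub>m (T + z \<cdot>\<^sub>m 1\<^sub>m d)"

text \<open>After \<open>F\<close> on the data register, a Hadamard test of \<open>T\<close>: the block matrix is the product of a
  Hadamard gate on the ancilla, \<open>T\<close> controlled on ancilla value 0, and the ancilla gate with rows
  \<open>(1, 1)\<close> and \<open>(\<i>, - \<i>)\<close> divided by the square root of 2.\<close>

definition hadamard_test :: "nat \<Rightarrow> complex mat \<Rightarrow> complex mat \<Rightarrow> complex mat" where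
  "hadamard_test d T F =
     four_block_mat (shifted_half d \<i> T) (shifted_half d (- \<i>) T)
       (shifted_half d (- \<i>) T) (shifted_half d \<i> T) *
     four_block_mat F (0\<^sub>m d d) (0\<^sub>m d d) F"

lemma shifted_half_carrier [simp]: "shifted_half d z T \<in> carrier_mat d d"
  by (simp add: shifted_half_def)

lemma shifted_half_index:
  assumes "T \<in> carrier_mat d d" "i < d" "j < d"
  shows "shifted_half d z T $$ (i, j) = (T $$ (i, j) + (if i = j then z else 0)) / 2"
  using assms by (simp add: shifted_half_def)

text \<open>Only the two mixed terms are interference terms. With \<open>z = w\<close>, passing from
  \<open>\<i>\<close> to \<open>- \<i>\<close> flips their signs and keeps the other two, so a
  difference of the two cases isolates them. The choice \<open>A = 1\<^sub>m d\<close> serves the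
  unitarity proof.\<close>

lemma shifted_half_sandwich_index:
  assumes T: "T \<in> carrier_mat d d" and A: "A \<in> carrier_mat d d" and ij: "i < d" "j < d"
  shows "(shifted_half d z T * A * mat_adjoint (shifted_half d w T)) $$ (i, j) =
    ((T * A * mat_adjoint T) $$ (i, j) + cnj w * (T * A) $$ (i, j) + z * (A * mat_adjoint T) $$ (i, j) +
      z * cnj w * A $$ (i, j)) / 4"
proof -
  note Ta = mat_adjoint_carrier[OF T]
  have half: "shifted_half d z T * A = (1 / 2) \<cdot>\<^sub>m (T * A + z \<cdot>\<^sub>m A)"
  proof -
    have "shifted_half d z T * A = (1 / 2) \<cdot>\<^sub>m ((T + z \<cdot>\<^sub>m 1\<^sub>m d) * A)"
      unfolding shifted_half_def using T A by (intro mult_smult_assoc_mat) auto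
    also have "(T + z \<cdot>\<^sub>m 1\<^sub>m d) * A = T * A + z \<cdot>\<^sub>m 1\<^sub>m d * A"
      using T A by (intro add_mult_distrib_mat) auto
    also have "z \<cdot>\<^sub>m 1\<^sub>m d * A = z \<cdot>\<^sub>m (1\<^sub>m d * A)"
      using A by (intro mult_smult_assoc_mat) auto
    finally show ?thesis using A by simp
  qed
  have adj: "mat_adjoint (shifted_half d w T) = (1 / 2) \<cdot>\<^sub>m (mat_adjoint T + cnj w \<cdot>\<^sub>m 1\<^sub>m d)"
    using Ta carrier_matD[OF mat_adjoint_carrier[OF shifted_half_carrier[of d w T]]]
    by (intro eq_matI) (auto simp: mat_adjoint_index[OF shifted_half_carrier]
        mat_adjoint_index[OF T] shifted_half_index[OF T])
  have right: "B * mat_adjoint (shifted_half d w T) = (1 / 2) \<cdot>\<^sub>m (B * mat_adjoint T + cnj w \<cdot>\<^sub>m B)"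
    if B: "B \<in> carrier_mat d d" for B
  proof -
    have "B * mat_adjoint (shifted_half d w T) = (1 / 2) \<cdot>\<^sub>m (B * (mat_adjoint T + cnj w \<cdot>\<^sub>m 1\<^sub>m d))"
      unfolding adj using Ta B by (intro mult_smult_distrib) auto
    also have "B * (mat_adjoint T + cnj w \<cdot>\<^sub>m 1\<^sub>m d) = B * mat_adjoint T + B * (cnj w \<cdot>\<^sub>m 1\<^sub>m d)"
      using Ta B by (intro mult_add_distrib_mat) auto
    also have "B * (cnj w \<cdot>\<^sub>m 1\<^sub>m d) = cnj w \<cdot>\<^sub>m (B * 1\<^sub>m d)"
      using B by (intro mult_smult_distrib) auto
    finally show ?thesis using B by simp
  qed
  define B where "B = shifted_half d z T * A"
  have B: "B \<in> carrier_mat d d" using A by (simp add: B_def mult_carrier_mat[of _ d d])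
  have BT: "B * mat_adjoint T = (1 / 2) \<cdot>\<^sub>m (T * A * mat_adjoint T + z \<cdot>\<^sub>m (A * mat_adjoint T))"
  proof -
    have "B * mat_adjoint T = (1 / 2) \<cdot>\<^sub>m ((T * A + z \<cdot>\<^sub>m A) * mat_adjoint T)"
      unfolding B_def half using T A Ta by (intro mult_smult_assoc_mat) auto
    also have "(T * A + z \<cdot>\<^sub>m A) * mat_adjoint T = T * A * mat_adjoint T + z \<cdot>\<^sub>m A * mat_adjoint T"
      using T A Ta by (intro add_mult_distrib_mat) auto
    also have "z \<cdot>\<^sub>m A * mat_adjoint T = z \<cdot>\<^sub>m (A * mat_adjoint T)"
      using A Ta by (intro mult_smult_assoc_mat) auto
    finally show ?thesis .
  qed
  have "(B * mat_adjoint (shifted_half d w T)) $$ (i, j) =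
      ((B * mat_adjoint T) $$ (i, j) + cnj w * B $$ (i, j)) / 2"
    unfolding right[OF B] using ij B Ta carrier_matD[OF Ta] carrier_matD[OF B]
    by (simp del: index_mult_mat(1))
  also have "(B * mat_adjoint T) $$ (i, j) =
      ((T * A * mat_adjoint T) $$ (i, j) + z * (A * mat_adjoint T) $$ (i, j)) / 2"
    unfolding BT using ij carrier_matD[OF T] carrier_matD[OF A] carrier_matD[OF Ta]
    by (simp del: index_mult_mat(1))
  also have "B $$ (i, j) = ((T * A) $$ (i, j) + z * A $$ (i, j)) / 2"
    unfolding B_def half using ij carrier_matD[OF T] carrier_matD[OF A]
    by (simp del: index_mult_mat(1))
  finally show ?thesis unfolding B_def by (simp add: algebra_simps add_divide_distrib)
qed

lemma mat_adjoint_four_block: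
  assumes "A \<in> carrier_mat d d" "B \<in> carrier_mat d d" "C \<in> carrier_mat d d" "E \<in> carrier_mat d d"
  shows "mat_adjoint (four_block_mat A B C E) =
    four_block_mat (mat_adjoint A) (mat_adjoint C) (mat_adjoint B) (mat_adjoint E :: complex mat)"
proof (rule eq_matI)
  note a = assms[THEN mat_adjoint_carrier]
  note dims = a[THEN carrier_matD(1)] a[THEN carrier_matD(2)]
    assms[THEN carrier_matD(1)] assms[THEN carrier_matD(2)]
  have c: "four_block_mat A B C E \<in> carrier_mat (d + d) (d + d)" using assms by simp
  note ad = carrier_matD[OF mat_adjoint_carrier[OF c]]
  fix i j assume "i < dim_row (four_block_mat (mat_adjoint A) (mat_adjoint C) (mat_adjoint B) (mat_adjoint E))"
    "j < dim_col (four_block_mat (mat_adjoint A) (mat_adjoint C) (mat_adjoint B) (mat_adjoint E))"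
  then have ij: "i < d + d" "j < d + d" by (auto simp: dims)
  then show "mat_adjoint (four_block_mat A B C E) $$ (i, j) =
      four_block_mat (mat_adjoint A) (mat_adjoint C) (mat_adjoint B) (mat_adjoint E) $$ (i, j)"
    by (auto simp: dims mat_adjoint_index[OF c ij] mat_adjoint_index[OF assms(1)]
        mat_adjoint_index[OF assms(2)] mat_adjoint_index[OF assms(3)] mat_adjoint_index[OF assms(4)])
qed (use assms assms[THEN mat_adjoint_carrier]
      carrier_matD[OF mat_adjoint_carrier[of "four_block_mat A B C E" "d + d" "d + d"]] in auto)

text \<open>In the diagonal blocks of the product with the adjoint the terms linear in
  \<open>T\<close> cancel. In the off-diagonal blocks \<open>1 + z * cnj w = 0\<close> as well,
  because \<open>z\<close> and \<open>w\<close> are opposite there.\<close>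

lemma unitary_hadamard_test:
  assumes T: "unitary_mat d T" and F: "unitary_mat d F"
  shows "unitary_mat (2 * d) (hadamard_test d T F)"
proof -
  let ?p = "shifted_half d \<i> T" and ?m = "shifted_half d (- \<i>) T"
  note Tc = unitary_matD[OF T] and Fc = unitary_matD[OF F]
  note ad = mat_adjoint_carrier[OF shifted_half_carrier]
  note dims = carrier_matD[OF ad] carrier_matD[OF shifted_half_carrier]
  have sw: "(shifted_half d z T * mat_adjoint (shifted_half d w T)) $$ (i, j) =
      ((1 + z * cnj w) * 1\<^sub>m d $$ (i, j) + cnj w * T $$ (i, j) + z * mat_adjoint T $$ (i, j)) / 4"
    if "i < d" "j < d" for z w i j
    using shifted_half_sandwich_index[OF Tc(1) one_carrier_mat that, of z w] Tc
    by (simp add: right_mult_one_mat[OF shifted_half_carrier] algebra_simps)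
  have diag: "?p * mat_adjoint ?p + ?m * mat_adjoint ?m = 1\<^sub>m d"
    "?m * mat_adjoint ?m + ?p * mat_adjoint ?p = 1\<^sub>m d"
    "?p * mat_adjoint ?m + ?m * mat_adjoint ?p = 0\<^sub>m d d"
    "?m * mat_adjoint ?p + ?p * mat_adjoint ?m = 0\<^sub>m d d"
    by (rule eq_matI; simp add: dims sw field_simps del: index_mult_mat(1) index_one_mat(1))+
  have "unitary_mat (d + d) (four_block_mat ?p ?m ?m ?p)"
  proof (rule unitary_matI)
    show "four_block_mat ?p ?m ?m ?p * mat_adjoint (four_block_mat ?p ?m ?m ?p) = 1\<^sub>m (d + d)"
      unfolding mat_adjoint_four_block[OF shifted_half_carrier shifted_half_carrier
          shifted_half_carrier shifted_half_carrier]
      by (subst mult_four_block_mat[OF shifted_half_carrier shifted_half_carrier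
          shifted_half_carrier shifted_half_carrier ad ad ad ad]) (simp add: diag)
  qed simp
  moreover have "unitary_mat (d + d) (four_block_mat F (0\<^sub>m d d) (0\<^sub>m d d) F)"
  proof (rule unitary_matI)
    show "four_block_mat F (0\<^sub>m d d) (0\<^sub>m d d) F * mat_adjoint (four_block_mat F (0\<^sub>m d d) (0\<^sub>m d d) F) =
        1\<^sub>m (d + d)"
      unfolding mat_adjoint_four_block[OF Fc(1) zero_carrier_mat zero_carrier_mat Fc(1)] mat_adjoint_zero
      using Fc by (subst mult_four_block_mat[of _ d d _ d _ d]) auto
  qed (use Fc in simp)
  ultimately show ?thesis unfolding hadamard_test_def mult_2 by (rule unitary_mat_mult)
qed

text \<open>The ancilla starts in state 0, so only the first block column of \<open>Q\<close> acts
  on \<open>R\<close>. Its two blocks give the unnormalized data states for ancilla outcomes 0 and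
  1.\<close>

lemma hadamard_test_diagonal:
  assumes T: "T \<in> carrier_mat d d" and F: "F \<in> carrier_mat d d" and R: "R \<in> carrier_mat d d"
    and a: "a < d"
  defines "S \<equiv> four_block_mat R (0\<^sub>m d d) (0\<^sub>m d d) (0\<^sub>m d d)"
    and "Q \<equiv> hadamard_test d T F"
    and "\<sigma> \<equiv> F * R * mat_adjoint F"
  shows "(Q * S * mat_adjoint Q) $$ (a, a) =
      (shifted_half d \<i> T * \<sigma> * mat_adjoint (shifted_half d \<i> T)) $$ (a, a)"
    and "(Q * S * mat_adjoint Q) $$ (d + a, d + a) =
      (shifted_half d (- \<i>) T * \<sigma> * mat_adjoint (shifted_half d (- \<i>) T)) $$ (a, a)"
proof -
  let ?p = "shifted_half d \<i> T" and ?m = "shifted_half d (- \<i>) T"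
  note Fa = mat_adjoint_carrier[OF F]
  have sc: "shifted_half d z T \<in> carrier_mat d d" "mat_adjoint (shifted_half d z T) \<in> carrier_mat d d"
    for z using mat_adjoint_carrier[OF shifted_half_carrier] by auto
  have pF: "shifted_half d z T * F \<in> carrier_mat d d" for z by (rule mult_carrier_mat[OF sc(1) F])
  have pFR: "shifted_half d z T * F * R \<in> carrier_mat d d" for z
    by (rule mult_carrier_mat[OF pF R])
  note pFa = mat_adjoint_carrier[OF pF]
  have Q: "Q = four_block_mat (?p * F) (?m * F) (?m * F) (?p * F)"
    unfolding Q_def hadamard_test_def using sc F
    by (subst mult_four_block_mat[of _ d d _ d _ d _ _ d _ d])
      (auto intro!: cong_four_block_mat simp: right_mult_zero_mat[OF sc(1)]
        right_add_zero_mat[OF pF] left_add_zero_mat[OF pF])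
  have QS: "Q * S = four_block_mat (?p * F * R) (0\<^sub>m d d) (?m * F * R) (0\<^sub>m d d)"
    unfolding Q S_def using pF R pFR
    by (subst mult_four_block_mat[of _ d d _ d _ d _ _ d _ d])
      (auto intro!: cong_four_block_mat simp: right_mult_zero_mat[OF pF])
  have s: "shifted_half d z T * F * R * mat_adjoint (shifted_half d z T * F) =
      shifted_half d z T * \<sigma> * mat_adjoint (shifted_half d z T)" for z
    unfolding mat_adjoint_mult[OF sc(1) F] \<sigma>_def using sc F R Fa
    by (simp add: assoc_mult_mat[of _ d d _ d _ d] mult_carrier_mat[of _ d d _ d])
  have QSQ: "Q * S * mat_adjoint Q = four_block_mat
      (?p * F * R * mat_adjoint (?p * F)) (?p * F * R * mat_adjoint (?m * F))
      (?m * F * R * mat_adjoint (?p * F)) (?m * F * R * mat_adjoint (?m * F))"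
    unfolding QS unfolding Q mat_adjoint_four_block[OF pF pF pF pF]
    by (subst mult_four_block_mat[OF pFR zero_carrier_mat pFR zero_carrier_mat pFa pFa pFa pFa])
      (auto intro!: cong_four_block_mat simp: left_mult_zero_mat[OF pFa]
        right_add_zero_mat[OF mult_carrier_mat[OF pFR pFa]])
  note c = carrier_matD[OF mult_carrier_mat[OF pFR pFa]]
  show "(Q * S * mat_adjoint Q) $$ (a, a) = (?p * \<sigma> * mat_adjoint ?p) $$ (a, a)"
    "(Q * S * mat_adjoint Q) $$ (d + a, d + a) = (?m * \<sigma> * mat_adjoint ?m) $$ (a, a)"
    unfolding QSQ s[symmetric] using a c by (simp_all del: index_mult_mat)
qed

section \<open>Outcome statistics of the Hadamard test\<close>

lemma sum_lessThan_add: "(\<Sum>i<m + n. f i) = (\<Sum>i<m. f i) + (\<Sum>i<n. f (m + i :: nat))"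
  for f :: "nat \<Rightarrow> 'a :: comm_monoid_add"
  by (induction n) (simp_all add: add.assoc)

text \<open>This makes \<open>pmf_measure_circuit\<close> applicable to the enlarged register. The
  quadratic form sees only the half of the vector with ancilla value 0, where it is the form of
  \<open>R\<close>.\<close>

lemma density_operator_with_ancilla:
  assumes "density_operator (2 ^ n) R"
  shows "density_operator (2 * 2 ^ n) (with_ancilla n R)"
proof -
  define d :: nat where "d = 2 ^ n"
  define S where "S = four_block_mat R (0\<^sub>m d d) (0\<^sub>m d d) (0\<^sub>m d d)"
  have R: "hermitian_mat d R" and pos: "\<And>v. v \<in> carrier_vec d \<Longrightarrow> 0 \<le> Re ((R *\<^sub>v v) \<bullet>c v)"
    and tr: "mat_trace R = 1"
    using assms by (auto simp: density_operator_def d_def)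
  note Rc = hermitian_matD(1,2)[OF R]
  have Sc: "S \<in> carrier_mat (d + d) (d + d)" using Rc by (simp add: S_def)
  have "mat_adjoint S = S"
    unfolding S_def mat_adjoint_four_block[OF Rc(1) zero_carrier_mat zero_carrier_mat zero_carrier_mat]
    by (simp add: Rc)
  moreover have "0 \<le> Re ((S *\<^sub>v v) \<bullet>c v)" if v: "v \<in> carrier_vec (d + d)" for v
  proof -
    define u w where "u = vec_first v d" and "w = vec_last v d"
    have uw: "u \<in> carrier_vec d" "w \<in> carrier_vec d" "v = u @\<^sub>v w"
      using v by (simp_all add: u_def w_def)
    have "S *\<^sub>v v = (R *\<^sub>v u + 0\<^sub>m d d *\<^sub>v w) @\<^sub>v (0\<^sub>m d d *\<^sub>v u + 0\<^sub>m d d *\<^sub>v w)"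
      unfolding S_def uw(3) by (rule four_block_mat_mult_vec) (use Rc uw in auto)
    also have "\<dots> = (R *\<^sub>v u) @\<^sub>v 0\<^sub>v d"
      using Rc uw by (intro eq_vecI) auto
    finally have "S *\<^sub>v v = (R *\<^sub>v u) @\<^sub>v 0\<^sub>v d" .
    moreover have "conjugate v = conjugate u @\<^sub>v conjugate w"
      unfolding uw(3) using uw(1,2) by (intro eq_vecI) auto
    ultimately have "(S *\<^sub>v v) \<bullet>c v = (R *\<^sub>v u) \<bullet>c u + 0\<^sub>v d \<bullet>c w"
      using scalar_prod_append[of "R *\<^sub>v u" d "0\<^sub>v d" d "conjugate u" "conjugate w"] Rc uw by simp
    then show ?thesis using pos[OF uw(1)] uw by simp
  qed
  moreover have "mat_trace S = 1"
    using tr Rc by (simp add: mat_trace_def S_def sum_lessThan_add)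
  ultimately show ?thesis using Sc
    by (simp add: density_operator_def hermitian_mat_def with_ancilla_def S_def d_def mult_2)
qed

lemma set_pmf_measure_circuit:
  assumes "unitary_mat d Q" "density_operator d S"
  shows "set_pmf (measure_circuit Q S) \<subseteq> {..<d}"
  using pmf_measure_circuit[OF assms] by (auto simp: set_pmf_iff split: if_splits)

text \<open>Outcome \<open>s\<close> of \<open>n + 1\<close> qubits consists of the ancilla bit \<open>s div d\<close>, which gives the sign, and the
  data outcome \<open>s mod d\<close>.\<close>

definition signed_weight :: "nat \<Rightarrow> (nat \<Rightarrow> real) \<Rightarrow> nat \<Rightarrow> real" where
  "signed_weight d g s = (if s < d then g s else - g (s - d))"

text \<open>Outcomes \<open>a\<close> and \<open>d + a\<close> share the data value and differ in
  the ancilla bit. Their signed combination keeps just the interference terms, and one run yields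
  every \<open>a\<close> at once, for arbitrary weights \<open>g\<close>.\<close>

lemma hadamard_test_expectation:
  fixes n :: nat
  defines "d \<equiv> 2 ^ n"
  assumes T: "unitary_mat d T" and F: "unitary_mat d F" and R: "density_operator d R"
  shows "measure_pmf.expectation (measure_circuit (hadamard_test d T F) (with_ancilla n R))
      (signed_weight d g) =
    - (\<Sum>a<d. g a * Im ((F * R * mat_adjoint F * mat_adjoint T) $$ (a, a)))"
proof -
  define Q S where "Q = hadamard_test d T F" and "S = with_ancilla n R"
  define \<sigma> where "\<sigma> = F * R * mat_adjoint F"
  have Rh: "hermitian_mat d R" using R by (simp add: density_operator_def)
  note Tc = unitary_matD[OF T] and Fc = unitary_matD[OF F]
  have \<sigma>: "hermitian_mat d \<sigma>" unfolding \<sigma>_def by (rule hermitian_mat_conjugate[OF Rh Fc(1)])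
  note \<sigma>c = hermitian_matD[OF \<sigma>]
  have Q: "unitary_mat (2 * d) Q" unfolding Q_def by (rule unitary_hadamard_test[OF T F])
  have S: "density_operator (2 * d) S"
    using density_operator_with_ancilla R by (simp add: S_def d_def)
  have S4: "S = four_block_mat R (0\<^sub>m d d) (0\<^sub>m d d) (0\<^sub>m d d)" by (simp add: S_def with_ancilla_def d_def)
  let ?q = "\<lambda>s. Re ((Q * S * mat_adjoint Q) $$ (s, s))"
  have "measure_pmf.expectation (measure_circuit Q S) (signed_weight d g) =
      (\<Sum>s<2 * d. signed_weight d g s * pmf (measure_circuit Q S) s)"
    using set_pmf_measure_circuit[OF Q S] by (intro integral_measure_pmf_real) auto
  also have "\<dots> = (\<Sum>s<2 * d. signed_weight d g s * ?q s)"
    by (intro sum.cong refl) (simp add: pmf_measure_circuit[OF Q S])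
  also have "\<dots> = (\<Sum>a<d. g a * (?q a - ?q (d + a)))"
    by (simp add: mult_2 sum_lessThan_add signed_weight_def sum_subtractf[symmetric] sum_negf
        right_diff_distrib)
  also have "\<dots> = (\<Sum>a<d. - (g a * Im ((\<sigma> * mat_adjoint T) $$ (a, a))))"
  proof (intro sum.cong refl)
    fix a assume "a \<in> {..<d}"
    then have a: "a < d" by simp
    define x where "x = (\<sigma> * mat_adjoint T) $$ (a, a)"
    have "(T * \<sigma>) $$ (a, a) = mat_adjoint (\<sigma> * mat_adjoint T) $$ (a, a)"
      using mat_adjoint_mult[OF \<sigma>c(1) Tc(2)] \<sigma>c(2) mat_adjoint_adjoint[OF Tc(1)] by simp
    also have "\<dots> = cnj x"
      unfolding x_def by (rule mat_adjoint_index[OF mult_carrier_mat[OF \<sigma>c(1) Tc(2)] a a])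
    finally have y: "(T * \<sigma>) $$ (a, a) = cnj x" .
    \<comment> \<open>With the Hermitian \<open>\<sigma>\<close> the two interference terms are
      conjugate to each other, and what remains is \<open>\<i> * (x - cnj x) / 2\<close>.\<close>
    have "?q a - ?q (d + a) = - Im x"
      unfolding S4 Q_def hadamard_test_diagonal[OF Tc(1) Fc(1) hermitian_matD(1)[OF Rh] a]
        \<sigma>_def[symmetric] shifted_half_sandwich_index[OF Tc(1) \<sigma>c(1) a a] y x_def[symmetric]
      by (simp add: field_simps)
    then show "g a * (?q a - ?q (d + a)) = - (g a * Im ((\<sigma> * mat_adjoint T) $$ (a, a)))"
      by (simp add: x_def)
  qed
  finally show ?thesis by (simp add: sum_negf Q_def S_def \<sigma>_def)
qed

text \<open>All parameters of the block share the circuits and differ only in the weights, because their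
  generators are diagonal in the measured basis.\<close>

lemma block_gradient_circuits:
  assumes circ: "commuting_block_circuit (2 ^ n) B N G U" and b: "b < B"
    and H: "hermitian_mat (2 ^ n) H"
  shows "\<exists>(Q :: nat \<Rightarrow> complex mat) w. (\<forall>s<2. unitary_mat (2 ^ (n + 1)) (Q s)) \<and>
    (\<forall>j<N b. \<forall>R. density_operator (2 ^ n) R \<longrightarrow>
      ((\<lambda>t. Re (mat_trace (H * (U (\<theta>(b := (\<theta> b)(j := t))) * R *
          mat_adjoint (U (\<theta>(b := (\<theta> b)(j := t)))))))) has_real_derivative
        (\<Sum>s<2. measure_pmf.expectation (measure_circuit (Q s) (with_ancilla n R)) (w j)))
        (at (\<theta> b j)))"
proof -
  define d :: nat where "d = 2 ^ n"
  obtain X F g where X: "unitary_mat d X" and F: "unitary_mat d F"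
    and U: "\<And>j t. j < N b \<Longrightarrow> U (\<theta>(b := (\<theta> b)(j := t))) =
       mat_adjoint X * mat_diag d (\<lambda>a. cis ((t - \<theta> b j) * g j a)) * F"
    using commuting_block_circuit_param[OF circ b, of \<theta>] unfolding d_def by blast
  have H: "hermitian_mat d H" using H by (simp add: d_def)
  note Xc = unitary_matD[OF X] and Fc = unitary_matD[OF F]
  obtain c W where W: "unitary_mat d W"
    and HW: "X * H * mat_adjoint X = complex_of_real (c / 2) \<cdot>\<^sub>m (W + mat_adjoint W)"
    using hermitian_mat_eq_unitary_mean[OF hermitian_mat_conjugate[OF H Xc(1)]] by blast
  note Wc = unitary_matD[OF W]
  \<comment> \<open>The test of \<open>T\<close> reports \<open>mat_adjoint T\<close>, so
    \<open>s = 0\<close> yields the part of \<open>mat_adjoint W\<close> and \<open>s = 1\<close>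
    that of \<open>W\<close>; only their sum matters.\<close>
  define T where "T s = (if s = 0 then W else mat_adjoint W)" for s :: nat
  have T: "unitary_mat d (T s)" for s using W unitary_mat_adjoint[OF W] by (simp add: T_def)
  have "((\<lambda>t. Re (mat_trace (H * (U (\<theta>(b := (\<theta> b)(j := t))) * R *
          mat_adjoint (U (\<theta>(b := (\<theta> b)(j := t)))))))) has_real_derivative
        (\<Sum>s<2. measure_pmf.expectation (measure_circuit (hadamard_test d (T s) F) (with_ancilla n R))
          (\<lambda>s. c * signed_weight d (g j) s))) (at (\<theta> b j))"
    if j: "j < N b" and R: "density_operator d R" for j R
  proof -
    define \<sigma> where "\<sigma> = F * R * mat_adjoint F"
    have Rh: "hermitian_mat d R" using R by (simp add: density_operator_def)
    have \<sigma>: "\<sigma> \<in> carrier_mat d d"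
      using hermitian_matD(1)[OF hermitian_mat_conjugate[OF Rh Fc(1)]] by (simp add: \<sigma>_def)
    have E: "measure_pmf.expectation (measure_circuit (hadamard_test d (T s) F) (with_ancilla n R))
          (signed_weight d (g j)) = - (\<Sum>a<d. g j a * Im ((\<sigma> * mat_adjoint (T s)) $$ (a, a)))" for s
      using hadamard_test_expectation[of n "T s" F R "g j"] T F R by (simp add: d_def \<sigma>_def)
    have T01: "T 0 = W" "T (Suc 0) = mat_adjoint W" by (simp_all add: T_def)
    have entry: "(\<sigma> * (X * H * mat_adjoint X)) $$ (a, a) =
        complex_of_real (c / 2) * ((\<sigma> * W) $$ (a, a) + (\<sigma> * mat_adjoint W) $$ (a, a))" if "a < d" for a
    proof -
      have "\<sigma> * (X * H * mat_adjoint X) = complex_of_real (c / 2) \<cdot>\<^sub>m (\<sigma> * (W + mat_adjoint W))"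
        unfolding HW using \<sigma> Wc by (intro mult_smult_distrib) auto
      also have "\<sigma> * (W + mat_adjoint W) = \<sigma> * W + \<sigma> * mat_adjoint W"
        using \<sigma> Wc by (intro mult_add_distrib_mat) auto
      finally show ?thesis using that carrier_matD[OF \<sigma>] carrier_matD[OF Wc(1)] carrier_matD[OF Wc(2)]
        by (simp del: index_mult_mat(1))
    qed
    have "(\<Sum>a<d. g j a * Im ((\<sigma> * (X * H * mat_adjoint X)) $$ (a, a))) =
        (\<Sum>a<d. g j a * (c / 2 * (Im ((\<sigma> * W) $$ (a, a)) + Im ((\<sigma> * mat_adjoint W) $$ (a, a)))))"
      by (intro sum.cong refl) (simp add: entry del: index_mult_mat(1))
    \<comment> \<open>The derivative's factor \<open>- 2\<close> times the \<open>c / 2\<close> of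
      the unitary mean is \<open>- c\<close>. The minus sign is supplied by the Hadamard test, which
      leaves \<open>c\<close> as the scale of the weights.\<close>
    then have "- 2 * (\<Sum>a<d. g j a * Im ((\<sigma> * (X * H * mat_adjoint X)) $$ (a, a))) =
        (\<Sum>s<2. measure_pmf.expectation (measure_circuit (hadamard_test d (T s) F) (with_ancilla n R))
          (\<lambda>s. c * signed_weight d (g j) s))"
      by (simp add: numeral_2_eq_2 E[of 0, unfolded T01] E[of "Suc 0", unfolded T01] T01
          mat_adjoint_adjoint[OF Wc(1)] sum_distrib_left sum.distrib
          sum_negf algebra_simps del: index_mult_mat(1))
    with has_real_derivative_phase_trace[OF Xc(1) Fc(1) H Rh U[OF j]] show ?thesis
      by (simp only: \<sigma>_def)
  qed
  moreover have "unitary_mat (2 ^ (n + 1)) (hadamard_test d (T s) F)" for s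
    using unitary_hadamard_test[OF T F, of s] by (simp add: d_def)
  ultimately show ?thesis
    by (intro exI[of _ "\<lambda>s. hadamard_test d (T s) F"] exI[of _ "\<lambda>j s. c * signed_weight d (g j) s"])
      (simp add: d_def)
qed

section \<open>The gradient estimator\<close>

text \<open>Linearity of expectation together with the marginals of the product distribution; finite
  supports provide integrability.\<close>

lemma expectation_sum_Pi_pmf:
  fixes w :: "'a \<Rightarrow> 'b \<Rightarrow> real"
  assumes "finite A" and fin: "\<And>i. i \<in> A \<Longrightarrow> finite (set_pmf (p i))"
  shows "measure_pmf.expectation (Pi_pmf A dflt p) (\<lambda>x. \<Sum>i\<in>A. w i (x i)) =
    (\<Sum>i\<in>A. measure_pmf.expectation (p i) (w i))"
proof -
  have "finite (set_pmf (Pi_pmf A dflt p))"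
    using assms by (simp add: set_Pi_pmf finite_PiE_dflt)
  then have "measure_pmf.expectation (Pi_pmf A dflt p) (\<lambda>x. \<Sum>i\<in>A. w i (x i)) =
      (\<Sum>i\<in>A. measure_pmf.expectation (Pi_pmf A dflt p) (\<lambda>x. w i (x i)))"
    by (intro Bochner_Integration.integral_sum integrable_measure_pmf_finite)
  also have "\<dots> = (\<Sum>i\<in>A. measure_pmf.expectation (p i) (w i))"
  proof (intro sum.cong refl)
    fix i assume "i \<in> A"
    then have "p i = map_pmf (\<lambda>x. x i) (Pi_pmf A dflt p)"
      using Pi_pmf_component[OF \<open>finite A\<close>, of i dflt p] by simp
    then show "measure_pmf.expectation (Pi_pmf A dflt p) (\<lambda>x. w i (x i)) =
        measure_pmf.expectation (p i) (w i)"
      by (simp add: integral_map_pmf)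
  qed
  finally show ?thesis .
qed

text \<open>The trace is linear in the mixture, so the loss can be differentiated one sub-unitary at
  a time.\<close>

lemma dqnn_loss_eq_sum:
  assumes H: "H \<in> carrier_mat d d" and R: "R \<in> carrier_mat d d"
    and U: "\<And>k. k < K \<Longrightarrow> U k (\<theta> k) \<in> carrier_mat d d"
  shows "dqnn_loss d K U H \<theta> \<alpha> R =
    (\<Sum>k<K. \<alpha> k * Re (mat_trace (H * (U k (\<theta> k) * R * mat_adjoint (U k (\<theta> k))))))"
proof -
  define V where "V k = U k (\<theta> k) * R * mat_adjoint (U k (\<theta> k))" for k
  have V: "V k \<in> carrier_mat d d" if "k < K" for k
    using U[OF that] mat_adjoint_carrier[OF U[OF that]] R by (simp add: V_def)
  have "mat_trace (H * dqnn_state d K U \<theta> \<alpha> R) =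
      (\<Sum>i<d. \<Sum>j<d. \<Sum>k<K. complex_of_real (\<alpha> k) * (H $$ (i, j) * V k $$ (j, i)))"
    using H by (simp add: mat_trace_def dqnn_state_def scalar_prod_def lessThan_atLeast0 V_def
        sum_distrib_left mult.left_commute)
  also have "\<dots> = (\<Sum>k<K. \<Sum>i<d. \<Sum>j<d. complex_of_real (\<alpha> k) * (H $$ (i, j) * V k $$ (j, i)))"
    by (subst sum.swap[of _ _ "{..<K}"]) (intro sum.cong refl sum.swap)
  also have "\<dots> = (\<Sum>k<K. complex_of_real (\<alpha> k) * mat_trace (H * V k))"
  proof (intro sum.cong refl)
    fix k assume "k \<in> {..<K}"
    then show "(\<Sum>i<d. \<Sum>j<d. complex_of_real (\<alpha> k) * (H $$ (i, j) * V k $$ (j, i))) =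
        complex_of_real (\<alpha> k) * mat_trace (H * V k)"
      using V[of k] H by (simp add: mat_trace_def scalar_prod_def lessThan_atLeast0 sum_distrib_left)
  qed
  finally show ?thesis by (simp add: dqnn_loss_def V_def)
qed

lemma commuting_block_circuit_carrier:
  assumes "commuting_block_circuit d B N G U"
  shows "U \<theta> \<in> carrier_mat d d"
proof -
  have U: "U \<theta> = block_circuit d B N G \<theta>"
    using assms by (simp add: commuting_block_circuit_def)
  have "unitary_mat d (mat_list_prod d (map (\<lambda>j. mat_exp ((\<i> * complex_of_real (\<theta> b j)) \<cdot>\<^sub>m G b j)) [0..<N b]))"
    if "b < B" for b
    using assms that by (intro commuting_block_unitary) (auto simp: commuting_block_circuit_def)
  then have "unitary_mat d (U \<theta>)"
    unfolding U block_circuit_def by (intro unitary_mat_list_prod) auto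
  then show ?thesis by (rule unitary_matD)
qed

text \<open>\<open>M\<close> is fixed first and sees only \<open>K\<close> and the block counts. The
  principal filter makes the bound uniform over all admissible pairs rather than merely asymptotic.
  \<open>Q\<close> and \<open>post\<close> precede the encoding \<open>\<rho>\<close>, so one choice
  works for every data state; unbiasedness says that the expected estimate is itself the
  gradient.\<close>

theorem corollary2:
  shows "\<exists>M :: nat \<times> (nat \<Rightarrow> nat) \<Rightarrow> nat.
    (\<lambda>(K, B). real (M (K, B)))
      \<in> O[principal {(K, B). 1 \<le> K \<and> (\<forall>k<K. 1 \<le> B k)}](\<lambda>(K, B). 2 * (\<Sum>k<K. real (B k)) - real K) \<and>
    (\<forall>(n :: nat) (K :: nat) (B :: nat \<Rightarrow> nat) (N :: nat \<Rightarrow> nat \<Rightarrow> nat)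
       (G :: nat \<Rightarrow> nat \<Rightarrow> nat \<Rightarrow> complex mat)
       (U :: nat \<Rightarrow> (nat \<Rightarrow> nat \<Rightarrow> real) \<Rightarrow> complex mat) (H :: complex mat)
       (\<alpha> :: nat \<Rightarrow> real) (\<theta> :: nat \<Rightarrow> nat \<Rightarrow> nat \<Rightarrow> real).
      hermitian_mat (2 ^ n) H \<longrightarrow>
      (\<forall>k<K. commuting_block_circuit (2 ^ n) (B k) (N k) (G k) (U k)) \<longrightarrow>
      prob_vector K \<alpha> \<longrightarrow>
      (\<exists>(Q :: nat \<Rightarrow> complex mat) (post :: (nat \<Rightarrow> nat) \<Rightarrow> nat \<times> nat \<times> nat \<Rightarrow> real).
         (\<forall>i<M (K, B). unitary_mat (2 ^ (n + 1)) (Q i)) \<and>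
         (\<forall>(\<rho> :: real vec \<Rightarrow> complex mat). (\<forall>x. density_operator (2 ^ n) (\<rho> x)) \<longrightarrow>
           (\<forall>x. has_gradient (\<lambda>\<theta>'. dqnn_loss (2 ^ n) K U H \<theta>' \<alpha> (\<rho> x))
                  (expected_estimate n (M (K, B)) Q post (\<rho> x)) (param_index K B N) \<theta>))))"
proof (intro exI[of _ "\<lambda>(K, B). 2 * (\<Sum>k<K. B k)"] conjI allI impI)
  show "(\<lambda>(K, B). real ((\<lambda>(K, B). 2 * (\<Sum>k<K. B k)) (K, B)))
      \<in> O[principal {(K, B). 1 \<le> K \<and> (\<forall>k<K. 1 \<le> B k)}](\<lambda>(K, B). 2 * (\<Sum>k<K. real (B k)) - real K)"
  \<comment> \<open>The constant 2 is attained when every \<open>B k\<close> is 1: then the left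
    side is \<open>2 * K\<close> and the bounding function is \<open>K\<close>.\<close>
  proof (rule landau_o.bigI[of 2])
    have "\<bar>2 * (\<Sum>k<K. real (B k))\<bar> \<le> 2 * \<bar>2 * (\<Sum>k<K. real (B k)) - real K\<bar>"
      if "\<forall>k<K. 1 \<le> B k" for K :: nat and B :: "nat \<Rightarrow> nat"
    proof -
      have "(\<Sum>k<K. 1) \<le> (\<Sum>k<K. real (B k))" using that by (intro sum_mono) auto
      then show ?thesis by simp
    qed
    then show "\<forall>\<^sub>F x in principal {(K, B). 1 \<le> K \<and> (\<forall>k<K. 1 \<le> B k)}.
        norm (case x of (K, B) \<Rightarrow> real ((\<lambda>(K, B). 2 * (\<Sum>k<K. B k)) (K, B)))
        \<le> 2 * norm (case x of (K, B) \<Rightarrow> 2 * (\<Sum>k<K. real (B k)) - real K)"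
      by (auto simp: eventually_principal)
  qed simp
next
  fix n K :: nat and B :: "nat \<Rightarrow> nat" and N :: "nat \<Rightarrow> nat \<Rightarrow> nat"
    and G :: "nat \<Rightarrow> nat \<Rightarrow> nat \<Rightarrow> complex mat"
    and U :: "nat \<Rightarrow> (nat \<Rightarrow> nat \<Rightarrow> real) \<Rightarrow> complex mat" and H :: "complex mat"
    and \<alpha> :: "nat \<Rightarrow> real" and \<theta> :: "nat \<Rightarrow> nat \<Rightarrow> nat \<Rightarrow> real"
  assume H: "hermitian_mat (2 ^ n) H"
    and circ: "\<forall>k<K. commuting_block_circuit (2 ^ n) (B k) (N k) (G k) (U k)"
  define M where "M = 2 * (\<Sum>k<K. B k)"
  let ?V = "\<lambda>k b j t. U k ((\<theta> k)(b := (\<theta> k b)(j := t)))"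
  let ?E = "\<lambda>Q R w. measure_pmf.expectation (measure_circuit Q (with_ancilla n R)) w"
  define P where "P k b Q w \<longleftrightarrow> (\<forall>s<2. unitary_mat (2 ^ (n + 1)) (Q s)) \<and>
      (\<forall>j<N k b. \<forall>R. density_operator (2 ^ n) R \<longrightarrow>
        ((\<lambda>t. Re (mat_trace (H * (?V k b j t * R * mat_adjoint (?V k b j t))))) has_real_derivative
          (\<Sum>s<2. ?E (Q s) R (w j))) (at (\<theta> k b j)))" for k b and Q :: "nat \<Rightarrow> complex mat" and w
  have "\<exists>Q w. P k b Q w" if "k < K" "b < B k" for k b
    unfolding P_def using block_gradient_circuits[OF circ[rule_format, OF that(1)] that(2) H] .
  then have "\<forall>k b. \<exists>Q w. k < K \<longrightarrow> b < B k \<longrightarrow> P k b Q w" by blast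
  then obtain C w where CP: "\<forall>k b. k < K \<longrightarrow> b < B k \<longrightarrow> P k b (C k b) (w k b)"
    unfolding choice_iff by blast
  have C: "unitary_mat (2 ^ (n + 1)) (C k b s)" if "k < K" "b < B k" "s < 2" for k b s
    using CP that by (simp add: P_def)
  have deriv: "((\<lambda>t. Re (mat_trace (H * (?V k b j t * R * mat_adjoint (?V k b j t))))) has_real_derivative
      (\<Sum>s<2. ?E (C k b s) R (w k b j))) (at (\<theta> k b j))"
    if "k < K" "b < B k" "j < N k b" "density_operator (2 ^ n) R" for k b j R
    using CP[rule_format, OF that(1,2)] that(3,4) unfolding P_def by blast
  \<comment> \<open>One label \<open>(k, b, s)\<close> for each of the two circuits of each block;
    the bijection \<open>h\<close> flattens the labels into the indices below
    \<open>M\<close>.\<close>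
  define I where "I = (SIGMA k:{..<K}. {..<B k} \<times> {..<2::nat})"
  have "finite I" "card I = M" by (simp_all add: I_def M_def sum_distrib_left mult.commute)
  then obtain h where h: "bij_betw h {..<M} I"
    using ex_bij_betw_nat_finite[of I] by (auto simp: lessThan_atLeast0)
  define Q where "Q i = (case h i of (k, b, s) \<Rightarrow> C k b s)" for i
  \<comment> \<open>A circuit contributes only to the components of its own block. The mixture
    weight \<open>\<alpha> k\<close> is applied here classically, so it leaves the circuits
    untouched.\<close>
  define wt where "wt i p y = (case (h i, p) of ((k', b', s), (k, b, j)) \<Rightarrow>
    if k' = k \<and> b' = b then \<alpha> k * w k b j y else 0)" for i p y
  define post where "post y p = (\<Sum>i<M. wt i p (y i))" for y :: "nat \<Rightarrow> nat" and p
  have hI: "h i \<in> I" if "i < M" for i using h that by (auto simp: bij_betw_def)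
  have Q: "unitary_mat (2 ^ (n + 1)) (Q i)" if "i < M" for i
    using hI[OF that] C by (auto simp: Q_def I_def)
  have estimate: "expected_estimate n M Q post R (k, b, j) = \<alpha> k * (\<Sum>s<2::nat. ?E (C k b s) R (w k b j))"
    if "k < K" "b < B k" and R: "density_operator (2 ^ n) R" for R k b j
  proof -
    have S: "density_operator (2 ^ (n + 1)) (with_ancilla n R)"
      using density_operator_with_ancilla[OF R] by simp
    have "expected_estimate n M Q post R (k, b, j) = (\<Sum>i<M. ?E (Q i) R (wt i (k, b, j)))"
      unfolding expected_estimate_def post_def
      using finite_subset[OF set_pmf_measure_circuit[OF Q S]] by (intro expectation_sum_Pi_pmf) auto
    also have "\<dots> = (\<Sum>i<M. case h i of (k', b', s) \<Rightarrow>
        if k' = k \<and> b' = b then \<alpha> k * ?E (C k b s) R (w k b j) else 0)"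
      by (intro sum.cong refl) (auto simp: Q_def wt_def[abs_def] split: prod.split)
    also have "\<dots> = (\<Sum>(k', b', s)\<in>I. if k' = k \<and> b' = b then \<alpha> k * ?E (C k b s) R (w k b j) else 0)"
      by (rule sum.reindex_bij_betw[OF h])
    \<comment> \<open>Only the two labels lying over the block \<open>(k, b)\<close>
      survive.\<close>
    also have "\<dots> = (\<Sum>(k', b', s)\<in>{k} \<times> {b} \<times> {..<2}. \<alpha> k * ?E (C k b s) R (w k b j))"
      using that \<open>finite I\<close> by (intro sum.mono_neutral_cong_right) (auto simp: I_def split: if_splits)
    also have "\<dots> = (\<Sum>s<2. \<alpha> k * ?E (C k b s) R (w k b j))"
      by (simp add: sum.cartesian_product[symmetric])
    finally show ?thesis by (simp add: sum_distrib_left)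
  qed
  have gradient: "has_gradient (\<lambda>\<theta>'. dqnn_loss (2 ^ n) K U H \<theta>' \<alpha> R) (expected_estimate n M Q post R)
      (param_index K B N) \<theta>" if R: "density_operator (2 ^ n) R" for R
    unfolding has_gradient_def param_index_def
  proof safe
    fix k b j assume kbj: "k < K" "b < B k" "j < N k b"
    let ?L = "\<lambda>t k'. Re (mat_trace (H * (U k' ((\<theta>(k := (\<theta> k)(b := (\<theta> k b)(j := t)))) k') * R *
      mat_adjoint (U k' ((\<theta>(k := (\<theta> k)(b := (\<theta> k b)(j := t)))) k')))))"
    have loss: "dqnn_loss (2 ^ n) K U H (\<theta>(k := (\<theta> k)(b := (\<theta> k b)(j := t)))) \<alpha> R =
        (\<Sum>k'<K. \<alpha> k' * ?L t k')" for t
      using circ R hermitian_matD(1)[OF H] commuting_block_circuit_carrier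
      by (intro dqnn_loss_eq_sum) (auto simp: density_operator_def hermitian_mat_def)
    let ?D = "\<Sum>s<2::nat. ?E (C k b s) R (w k b j)"
    have "((\<lambda>t. \<Sum>k'<K. \<alpha> k' * ?L t k') has_real_derivative (\<Sum>k'<K. \<alpha> k' * (if k' = k then ?D else 0)))
        (at (\<theta> k b j))"
    proof (intro DERIV_sum DERIV_cmult)
      \<comment> \<open>Independence of the parameters enters here: for \<open>k'\<close> other than
        \<open>k\<close> the term is constant in \<open>t\<close>, so its derivative is 0.\<close>
      fix k' show "((\<lambda>t. ?L t k') has_real_derivative (if k' = k then ?D else 0)) (at (\<theta> k b j))"
        using deriv[OF kbj R] by simp
    qed
    moreover have "(\<Sum>k'<K. \<alpha> k' * (if k' = k then ?D else 0)) = expected_estimate n M Q post R (k, b, j)"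
      using kbj by (simp add: estimate[OF kbj(1,2) R] if_distrib[of "\<lambda>x. _ * x"] cong: if_cong)
    ultimately show "((\<lambda>t. dqnn_loss (2 ^ n) K U H (\<theta>(k := (\<theta> k)(b := (\<theta> k b)(j := t)))) \<alpha> R)
        has_real_derivative expected_estimate n M Q post R (k, b, j)) (at (\<theta> k b j))"
      by (simp only: loss)
  qed
  have M: "(\<lambda>(K, B). 2 * (\<Sum>k<K. B k)) (K, B) = M" by (simp add: M_def)
  show "\<exists>Q post. (\<forall>i<(\<lambda>(K, B). 2 * (\<Sum>k<K. B k)) (K, B). unitary_mat (2 ^ (n + 1)) (Q i)) \<and>
      (\<forall>\<rho> :: real vec \<Rightarrow> complex mat. (\<forall>x. density_operator (2 ^ n) (\<rho> x)) \<longrightarrow>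
        (\<forall>x. has_gradient (\<lambda>\<theta>'. dqnn_loss (2 ^ n) K U H \<theta>' \<alpha> (\<rho> x))
          (expected_estimate n ((\<lambda>(K, B). 2 * (\<Sum>k<K. B k)) (K, B)) Q post (\<rho> x)) (param_index K B N) \<theta>))"
    unfolding M using Q gradient by blast
qed

end
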